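(* Let $C_n^2$ be the double-edge cycle graph. The genus distribution of $C_n^2$ is asymptotically normal with mean $\frac14 n$ and variance $\frac{3}{32}n$ as $n\to\infty$. Furthermore, setting $t=\dfrac{1}{1-2g/n}$, as $n\to\infty$ and uniformly for $g/n$ in any closed subinterval of $(0,1/2)$ ($g$ an integer), we have $$\gamma_g(C_n^2)\sim \frac{t}{3}\sqrt{\frac{2t(t^2-1)}{\pi n}}\left(\frac{3}{t^2-1}\right)^{g}\bigl(2(1+t)\bigr)^{n}.$$
   Context: $C_n^2$ is the graph obtained from the cycle graph $C_n$ with $n$ vertices by replacing each edge with a pair of parallel edges (for $n=1$: one vertex with two loops; for $n=2$: two vertices joined by four parallel edges). Orientable cellular embeddings of a connected graph $G$ are counted as rotation systems, i.e. a choice of cyclic order of the edge-ends around each vertex. The genus $g$ of an embedding with $f$ faces is given by $|V|-|E|+f=2-2g$. $\gamma_g(G)$ denotes the number of orientable embeddings (rotation systems) of $G$ of genus $g$. $\gamma_G$ denotes the genus of a uniformly random rotation system of $G$. "Asymptotically normal with mean $e_n$ and variance $v_n$" means that $(\gamma_{C_n^2}-e_n)/\sqrt{v_n}$ converges in distribution to $\mathcal N(0,1)$ as $n\to\infty$. *)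

theory Defs
  imports
    "HOL-Probability.Probability"
    "HOL-Combinatorics.Orbits"
    "Graph_Theory.Bidirected_Digraph"
begin

(* A multigraph (loops and parallel edges allowed) is represented by a
   bidirected digraph: the arcs are the edge-ends, the arc a being the end at
   tail G a of the edge {a, arev a}.  A loop thus contributes two edge-ends to
   its vertex. *)

definition edges :: "('a, 'b) pre_digraph \<Rightarrow> ('b \<Rightarrow> 'b) \<Rightarrow> 'b set set" where
  "edges G arev = (\<lambda>a. {a, arev a}) ` arcs G"

(* The cyclic orders at the vertices are collected into one permutation of the
   edge-ends, sending every edge-end to the next one around its vertex. *)
definition rotation_systems :: "('a, 'b) pre_digraph \<Rightarrow> ('b \<Rightarrow> 'b) set" where
  "rotation_systems G =
     {\<sigma>. \<sigma> permutes arcs G \<and>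
          (\<forall>v\<in>verts G. out_arcs G v \<noteq> {} \<longrightarrow> cyclic_on \<sigma> (out_arcs G v))}"

(* Face tracing: traverse the edge from the end a to its other end arev a, and
   leave along the next edge-end in the rotation. *)
definition faces :: "('a, 'b) pre_digraph \<Rightarrow> ('b \<Rightarrow> 'b) \<Rightarrow> ('b \<Rightarrow> 'b) \<Rightarrow> 'b set set" where
  "faces G arev \<sigma> = orbit (\<sigma> \<circ> arev) ` arcs G"

(* The solution g of |V| - |E| + f = 2 - 2 g for a connected graph with at
   least one edge; it is real-valued, so no rounding is involved. *)
definition genus :: "('a, 'b) pre_digraph \<Rightarrow> ('b \<Rightarrow> 'b) \<Rightarrow> ('b \<Rightarrow> 'b) \<Rightarrow> real" where
  "genus G arev \<sigma> =
     (2 - (real (card (verts G)) - real (card (edges G arev))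
           + real (card (faces G arev \<sigma>)))) / 2"

definition num_embeddings :: "nat \<Rightarrow> ('a, 'b) pre_digraph \<Rightarrow> ('b \<Rightarrow> 'b) \<Rightarrow> nat" where
  "num_embeddings g G arev = card {\<sigma> \<in> rotation_systems G. genus G arev \<sigma> = real g}"

definition genus_distribution :: "('a, 'b) pre_digraph \<Rightarrow> ('b \<Rightarrow> 'b) \<Rightarrow> real pmf" where
  "genus_distribution G arev = map_pmf (genus G arev) (pmf_of_set (rotation_systems G))"

definition asymptotically_normal ::
    "(nat \<Rightarrow> real pmf) \<Rightarrow> (nat \<Rightarrow> real) \<Rightarrow> (nat \<Rightarrow> real) \<Rightarrow> bool" where
  "asymptotically_normal X e v \<longleftrightarrow>
     weak_conv_m (\<lambda>n. distr (measure_pmf (X n)) borel (\<lambda>x. (x - e n) / sqrt (v n)))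
       std_normal_distribution"

(* The edges are the pairs (i, k) with i < n and k a boolean; (i, k) joins i to
   i + 1 modulo n.  The end of (i, k) at i is (i, k, False), the one at i + 1 is
   (i, k, True). *)
definition double_cycle :: "nat \<Rightarrow> (nat, nat \<times> bool \<times> bool) pre_digraph" where
  "double_cycle n =
     \<lparr> verts = {..<n},
       arcs = {..<n} \<times> UNIV,
       tail = (\<lambda>(i, k, d). if d then Suc i mod n else i),
       head = (\<lambda>(i, k, d). if d then i else Suc i mod n) \<rparr>"

definition double_cycle_rev :: "nat \<Rightarrow> nat \<times> bool \<times> bool \<Rightarrow> nat \<times> bool \<times> bool" where
  "double_cycle_rev n = (\<lambda>(i, k, d). if i < n then (i, k, \<not> d) else (i, k, d))"

lemma fin_digraph_double_cycle: "fin_digraph (double_cycle n)"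
  by unfold_locales (auto simp: double_cycle_def split: if_splits)

lemma bidirected_digraph_double_cycle:
  "bidirected_digraph (double_cycle n) (double_cycle_rev n)"
proof -
  interpret fin_digraph "double_cycle n"
    by (rule fin_digraph_double_cycle)
  show ?thesis
    by unfold_locales (auto simp: double_cycle_def double_cycle_rev_def split: if_splits)
qed

end

theory Submission
  imports Defs "HOL-Computational_Algebra.Polynomial" "HOL-Real_Asymp.Real_Asymp"
begin

text \<open>
  For a natural number \<open>N\<close>, the power \<open>N ^ f\<close> of the number of faces counts the colourings of the
  edge-ends by \<open>N\<close> colours that are constant along faces. Summed over all rotation systems, this is
  the trace of the \<open>n\<close>-th power of a transfer operator on functions of the four colours along one
  double edge. Of the six rotations at a vertex, four lead one strand through in each direction and
  bounce the others, so they factor through a pair of colours (\<open>K_op \<circ> H_op\<close>); the other two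
  rotations permute the strands (\<open>B_op\<close>). This makes the operator a block matrix with eigenvalues
  solving \<open>\<lambda>\<^sup>2 = 4 N \<lambda> + 12\<close> and \<open>\<lambda>\<^sup>2 = 2 N \<lambda> + 12\<close>, apart from powers of two. As this holds for all \<open>N\<close>, it
  gives the generating polynomial of the number of faces. Its coefficients are explicit, and
  Stirling's formula yields the uniform estimate; its values near \<open>1\<close> on the unit circle yield
  the characteristic function and thus the normal limit.
\<close>

section \<open>Rotation systems and colourings of the edge-ends\<close>

text \<open>Faces are global objects, but being constant along faces is a condition at each vertex
  separately; this is why colourings are counted. The resulting operator acts on functions of
  \<open>N ^ 4\<close> tuples and is never diagonalised: a few relations between
  \<open>H_op\<close>, \<open>B_op\<close> and \<open>K_op\<close> show that it preserves the sum of
  the images of \<open>K_op\<close> and \<open>B_op \<circ> K_op\<close>, so its powers obey a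
  two-term recursion. The constants come from the dominant eigenvalue
  \<open>2 * (x + sqrt (x^2 + 3))\<close> at face weight \<open>x\<close>. It is
  \<open>6 = 3!\<close> at \<open>x = 1\<close>, and there its logarithm, as a function of
  \<open>ln x\<close>, has first derivative \<open>1/2\<close> and second derivative
  \<open>3/8\<close>. So the number \<open>f\<close> of faces has mean about \<open>n/2\<close> and
  variance about \<open>3n/8\<close>, and the genus \<open>(n + 2 - f) / 2\<close> has mean about
  \<open>n/4\<close> and variance about \<open>3n/32\<close>.\<close>

lemma card_orbit_invariant_functions:
  fixes N :: nat
  assumes fin: "finite A" and perm: "\<phi> permutes A"
  shows "card {f \<in> A \<rightarrow>\<^sub>E {..<N}. \<forall>a\<in>A. f (\<phi> a) = f a} = N ^ card (orbit \<phi> ` A)"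
proof -
  let ?O = "orbit \<phi> ` A"
  let ?F = "{f \<in> A \<rightarrow>\<^sub>E {..<N}. \<forall>a\<in>A. f (\<phi> a) = f a}"
  have p: "permutation \<phi>"
    using assms permutation_permutes by blast
  have const: "f b = f a" if "f \<in> ?F" "a \<in> A" "b \<in> orbit \<phi> a" for f a b
  proof -
    have "b \<in> A \<and> f b = f a"
      using that(3)
      by induction (use that perm in \<open>auto simp: permutes_in_image\<close>)
    then show ?thesis ..
  qed
  have "bij_betw (\<lambda>h. \<lambda>a\<in>A. h (orbit \<phi> a)) (?O \<rightarrow>\<^sub>E {..<N}) ?F"
    unfolding bij_betw_def
  proof
    show "inj_on (\<lambda>h. \<lambda>a\<in>A. h (orbit \<phi> a)) (?O \<rightarrow>\<^sub>E {..<N})"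
    proof (rule inj_onI)
      fix g h assume g: "g \<in> ?O \<rightarrow>\<^sub>E {..<N}" and h: "h \<in> ?O \<rightarrow>\<^sub>E {..<N}"
        and eq: "(\<lambda>a\<in>A. g (orbit \<phi> a)) = (\<lambda>a\<in>A. h (orbit \<phi> a))"
      show "g = h"
      proof (rule PiE_ext[OF g h])
        fix X assume "X \<in> ?O"
        then obtain a where "a \<in> A" "X = orbit \<phi> a" by blast
        then show "g X = h X"
          using fun_cong[OF eq, of a] by simp
      qed
    qed
    show "(\<lambda>h. \<lambda>a\<in>A. h (orbit \<phi> a)) ` (?O \<rightarrow>\<^sub>E {..<N}) = ?F"
    proof (intro equalityI subsetI)
      fix f assume "f \<in> (\<lambda>h. \<lambda>a\<in>A. h (orbit \<phi> a)) ` (?O \<rightarrow>\<^sub>E {..<N})"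
      then show "f \<in> ?F"
        using perm by (auto simp: permutes_in_image permutation_orbit_step[OF p])
    next
      fix f assume f: "f \<in> ?F"
      \<comment> \<open>The colour of an orbit is read at an arbitrary element; by
        \<open>const\<close> the choice does not matter.\<close>
      define h where "h = (\<lambda>X\<in>?O. f (SOME a. a \<in> X))"
      have h_orbit: "h (orbit \<phi> a) = f a" if "a \<in> A" for a
      proof -
        have "(SOME b. b \<in> orbit \<phi> a) \<in> orbit \<phi> a"
          using orbit_nonempty[of \<phi> a] by (simp add: some_in_eq)
        then show ?thesis
          using const[OF f that] that by (simp add: h_def)
      qed
      have "h \<in> ?O \<rightarrow>\<^sub>E {..<N}"
      proof (rule PiE_I)
        fix X assume "X \<in> ?O"
        then show "h X \<in> {..<N}" using h_orbit f by auto
      qed (simp add: h_def)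
      moreover have "f = (\<lambda>a\<in>A. h (orbit \<phi> a))"
        using f h_orbit by (auto simp: fun_eq_iff PiE_def extensional_def)
      ultimately show "f \<in> (\<lambda>h. \<lambda>a\<in>A. h (orbit \<phi> a)) ` (?O \<rightarrow>\<^sub>E {..<N})"
        by blast
    qed
  qed
  then have "card ?F = card (?O \<rightarrow>\<^sub>E {..<N})"
    by (rule bij_betw_same_card[symmetric])
  also have "\<dots> = N ^ card ?O"
    using fin by (subst card_PiE) auto
  finally show ?thesis .
qed

section \<open>Rotation systems as independent local rotations\<close>

text \<open>The four edge-ends at a vertex: the flag \<open>d\<close> says whether the edge leads back to the
  previous vertex, and \<open>k\<close> distinguishes the two parallel edges.\<close>

definition vertex_end :: "nat \<Rightarrow> nat \<Rightarrow> bool \<times> bool \<Rightarrow> nat \<times> bool \<times> bool" where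
  "vertex_end n i = (\<lambda>(d, k). (if d then (i + n - 1) mod n else i, k, d))"

text \<open>Glues one permutation of the labels \<open>(d, k)\<close> per vertex along the
  labellings \<open>vertex_end n i\<close>, where \<open>i\<close> is the tail of the given
  edge-end. Triples with \<open>j \<ge> n\<close> are not arcs and must be fixed for the result to
  permute the arcs.\<close>

definition rotation_of ::
    "nat \<Rightarrow> (nat \<Rightarrow> bool \<times> bool \<Rightarrow> bool \<times> bool) \<Rightarrow> nat \<times> bool \<times> bool \<Rightarrow> nat \<times> bool \<times> bool" where
  "rotation_of n T = (\<lambda>(j, k, d). if j < n
     then let i = (if d then Suc j mod n else j) in vertex_end n i (T i (d, k)) else (j, k, d))"

definition local_rotations :: "(bool \<times> bool \<Rightarrow> bool \<times> bool) set" where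
  "local_rotations = {\<tau>. cyclic_on \<tau> UNIV}"

text \<open>The cyclic predecessor has the form \<open>i + n - 1\<close> because
  \<open>i - 1\<close> truncates at \<open>0\<close>.\<close>

lemma Suc_mod_eq_iff:
  fixes i j n :: nat
  assumes "i < n" "j < n"
  shows "Suc j mod n = i \<longleftrightarrow> j = (i + n - 1) mod n"
proof (cases i)
  case 0
  have "(i + n - 1) mod n = n - 1"
    using assms 0 by simp
  moreover have "Suc j mod n = (if Suc j = n then 0 else Suc j)"
    using assms by auto
  ultimately show ?thesis
    using assms 0 by auto
next
  case (Suc m)
  then have "(i + n - 1) mod n = m"
    using assms by simp
  moreover have "Suc j mod n = (if Suc j = n then 0 else Suc j)"
    using assms by auto
  ultimately show ?thesis
    using assms Suc by auto
qed

lemma Suc_pred_mod: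
  fixes i n :: nat
  assumes "i < n"
  shows "Suc ((i + n - 1) mod n) mod n = i"
  using assms Suc_mod_eq_iff[of i n "(i + n - 1) mod n", THEN iffD2, OF _ _ refl] by simp

lemma rotation_of_vertex_end:
  assumes "i < n"
  shows "rotation_of n T (vertex_end n i p) = vertex_end n i (T i p)"
  using assms Suc_pred_mod[OF assms]
  by (cases p; cases "T i p") (auto simp: rotation_of_def vertex_end_def Let_def)

lemma tail_vertex_end:
  assumes "i < n"
  shows "tail (double_cycle n) (vertex_end n i p) = i"
  using Suc_pred_mod[OF assms]
  by (cases p) (simp add: double_cycle_def vertex_end_def del: One_nat_def)

text \<open>The vertex is recovered as the tail, and the label is stored in the edge-end itself. So
  this also holds for \<open>n = 1\<close> and \<open>n = 2\<close>, where the two neighbours of a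
  vertex coincide.\<close>

lemma vertex_end_eq_iff:
  assumes "i < n" "i' < n"
  shows "vertex_end n i p = vertex_end n i' p' \<longleftrightarrow> i = i' \<and> p = p'"
proof
  assume eq: "vertex_end n i p = vertex_end n i' p'"
  have "i = i'"
    using arg_cong[OF eq, of "tail (double_cycle n)"] assms by (simp only: tail_vertex_end)
  moreover have "p = p'"
    using eq by (cases p; cases p') (simp add: vertex_end_def)
  ultimately show "i = i' \<and> p = p'" ..
qed simp

lemma out_arcs_double_cycle:
  assumes "i < n"
  shows "out_arcs (double_cycle n) i = range (vertex_end n i)"
proof (intro equalityI subsetI)
  fix a assume a: "a \<in> out_arcs (double_cycle n) i"
  obtain j k d where [simp]: "a = (j, k, d)" by (cases a)
  have "a = vertex_end n i (d, k)"
    using a assms Suc_mod_eq_iff[of i n j]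
    by (auto simp: double_cycle_def vertex_end_def out_arcs_def)
  then show "a \<in> range (vertex_end n i)" by blast
next
  fix a assume "a \<in> range (vertex_end n i)"
  then obtain p where a: "a = vertex_end n i p" by blast
  have "vertex_end n i p \<in> arcs (double_cycle n)"
    using assms by (cases p) (simp add: double_cycle_def vertex_end_def)
  then show "a \<in> out_arcs (double_cycle n) i"
    using assms by (simp add: a out_arcs_def tail_vertex_end)
qed

lemma arcs_double_cycle: "arcs (double_cycle n) = (\<Union>i<n. range (vertex_end n i))"
proof -
  have "arcs (double_cycle n) = (\<Union>i<n. out_arcs (double_cycle n) i)"
    by (auto simp: double_cycle_def out_arcs_def)
  then show ?thesis by (simp add: out_arcs_double_cycle)
qed

lemma cyclic_on_image_eq:
  assumes "cyclic_on f S"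
  shows "f ` S = S"
proof (intro equalityI subsetI)
  fix y assume y: "y \<in> S"
  then have "y \<in> orbit f y"
    using assms by (simp add: orbit_cyclic_eq3)
  then show "y \<in> f ` S"
    by cases (use assms y in \<open>auto simp: orbit_cyclic_eq3\<close>)
qed (use assms in \<open>auto intro: cyclic_on_inI\<close>)

text \<open>The tails partition the edge-ends, so the cyclic orders are chosen independently. This
  lets the sum over rotation systems factor over the vertices.\<close>

lemma bij_betw_rotation_of:
  "bij_betw (rotation_of n) ({..<n} \<rightarrow>\<^sub>E local_rotations) (rotation_systems (double_cycle n))"
  unfolding bij_betw_def
proof
  let ?A = "arcs (double_cycle n)"
  have finA: "finite ?A" by (simp add: double_cycle_def)
  show "inj_on (rotation_of n) ({..<n} \<rightarrow>\<^sub>E local_rotations)"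
  proof (rule inj_onI)
    fix T T' assume T: "T \<in> {..<n} \<rightarrow>\<^sub>E local_rotations" "T' \<in> {..<n} \<rightarrow>\<^sub>E local_rotations"
      and eq: "rotation_of n T = rotation_of n T'"
    show "T = T'"
    proof (rule PiE_ext[OF T])
      fix i assume "i \<in> {..<n}"
      then show "T i = T' i"
        using fun_cong[OF eq, of "vertex_end n i p" for p]
        by (simp add: fun_eq_iff rotation_of_vertex_end vertex_end_eq_iff)
    qed
  qed
  show "rotation_of n ` ({..<n} \<rightarrow>\<^sub>E local_rotations) = rotation_systems (double_cycle n)"
  proof (intro equalityI subsetI)
    fix \<sigma> assume "\<sigma> \<in> rotation_of n ` ({..<n} \<rightarrow>\<^sub>E local_rotations)"
    then obtain T where T: "T \<in> {..<n} \<rightarrow>\<^sub>E local_rotations" and \<sigma>: "\<sigma> = rotation_of n T" by blast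
    have cyc: "cyclic_on (T i) UNIV" if "i < n" for i
      using T that by (auto simp: local_rotations_def)
    have img: "\<sigma> ` range (vertex_end n i) = range (vertex_end n i)" if "i < n" for i
    proof -
      have "\<sigma> ` range (vertex_end n i) = vertex_end n i ` range (T i)"
        using that by (simp add: image_image \<sigma> rotation_of_vertex_end)
      then show ?thesis using cyclic_on_image_eq[OF cyc[OF that]] by simp
    qed
    have "\<sigma> ` ?A = ?A"
      unfolding arcs_double_cycle image_UN using img by simp
    then have "bij_betw \<sigma> ?A ?A"
      using finA by (simp add: bij_betw_def eq_card_imp_inj_on)
    then have "\<sigma> permutes ?A"
    proof (rule bij_imp_permutes)
      fix a assume "a \<notin> ?A"
      then show "\<sigma> a = a"
        by (cases a) (simp add: \<sigma> rotation_of_def double_cycle_def)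
    qed
    moreover have "cyclic_on \<sigma> (out_arcs (double_cycle n) i)" if "i < n" for i
      unfolding out_arcs_double_cycle[OF that]
      by (rule cyclic_on_image[OF cyc[OF that]]) (simp add: \<sigma> rotation_of_vertex_end that)
    ultimately show "\<sigma> \<in> rotation_systems (double_cycle n)"
      by (auto simp: rotation_systems_def double_cycle_def)
  next
    fix \<sigma> assume \<sigma>: "\<sigma> \<in> rotation_systems (double_cycle n)"
    have cyc: "cyclic_on \<sigma> (range (vertex_end n i))" if "i < n" for i
    proof -
      have "i \<in> verts (double_cycle n)"
        using that by (simp add: double_cycle_def)
      moreover have "out_arcs (double_cycle n) i \<noteq> {}"
        using that by (simp add: out_arcs_double_cycle)
      ultimately have "cyclic_on \<sigma> (out_arcs (double_cycle n) i)"
        using \<sigma> by (simp add: rotation_systems_def)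
      then show ?thesis
        using that by (simp add: out_arcs_double_cycle)
    qed
    \<comment> \<open>The local rotation at \<open>i\<close> is \<open>\<sigma>\<close> pulled back
      along the injective labelling \<open>vertex_end n i\<close>.\<close>
    define T where "T = (\<lambda>i\<in>{..<n}. \<lambda>p. inv (vertex_end n i) (\<sigma> (vertex_end n i p)))"
    have T: "\<sigma> (vertex_end n i p) = vertex_end n i (T i p)" if "i < n" for i p
      using cyclic_on_inI[OF cyc[OF that], of "vertex_end n i p"] that
      by (simp add: T_def f_inv_into_f)
    have inj: "inj (vertex_end n i)" if "i < n" for i
      using that by (auto simp: inj_def vertex_end_eq_iff)
    have "cyclic_on (T i) UNIV" if "i < n" for i
    proof -
      have "cyclic_on (T i) (inv (vertex_end n i) ` range (vertex_end n i))"
        by (rule cyclic_on_image[OF cyc[OF that]]) (use that inj in \<open>auto simp: T\<close>)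
      also have "inv (vertex_end n i) ` range (vertex_end n i) = UNIV"
        by (simp add: image_image inv_f_f[OF inj[OF that]])
      finally show ?thesis .
    qed
    then have "T \<in> {..<n} \<rightarrow>\<^sub>E local_rotations"
      by (auto simp: local_rotations_def T_def)
    moreover have "\<sigma> = rotation_of n T"
    proof
      fix a
      show "\<sigma> a = rotation_of n T a"
      proof (cases "a \<in> ?A")
        case True
        then obtain i p where "i < n" "a = vertex_end n i p"
          by (auto simp: arcs_double_cycle)
        then show ?thesis by (simp add: T rotation_of_vertex_end)
      next
        case False
        then have "\<sigma> a = a"
          using \<sigma> by (auto simp: rotation_systems_def dest: permutes_not_in)
        then show ?thesis
          using False by (cases a) (auto simp: rotation_of_def double_cycle_def split: if_splits)
      qed
    qed
    ultimately show "\<sigma> \<in> rotation_of n ` ({..<n} \<rightarrow>\<^sub>E local_rotations)" by blast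
  qed
qed

section \<open>Colourings as sequences of colour tuples\<close>

text \<open>The colours on the double edge from \<open>i\<close> to \<open>i + 1\<close> form a tuple \<open>(a1, a2, b1, b2)\<close>: \<open>a1\<close>, \<open>a2\<close> are
  the colours of the two ends at \<open>i\<close>, and \<open>b1\<close>, \<open>b2\<close> those at \<open>i + 1\<close>. A face traced into a vertex along
  an edge arrives with the colour of the far end of that edge (\<open>in_colour\<close>) and leaves along an end at
  the vertex (\<open>out_colour\<close>).\<close>

definition out_colour :: "nat \<times> nat \<times> nat \<times> nat \<Rightarrow> nat \<times> nat \<times> nat \<times> nat \<Rightarrow> bool \<times> bool \<Rightarrow> nat" where
  "out_colour = (\<lambda>(a1, a2, b1, b2) (c1, c2, d1, d2) (d, k).
     if d then (if k then b2 else b1) else (if k then c2 else c1))"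

definition in_colour :: "nat \<times> nat \<times> nat \<times> nat \<Rightarrow> nat \<times> nat \<times> nat \<times> nat \<Rightarrow> bool \<times> bool \<Rightarrow> nat" where
  "in_colour = (\<lambda>(a1, a2, b1, b2) (c1, c2, d1, d2) (d, k).
     if d then (if k then a2 else a1) else (if k then d2 else d1))"

definition vertex_weight :: "nat \<times> nat \<times> nat \<times> nat \<Rightarrow> nat \<times> nat \<times> nat \<times> nat \<Rightarrow> nat" where
  "vertex_weight u v =
     (\<Sum>\<tau>\<in>local_rotations. of_bool (\<forall>p. out_colour u v (\<tau> p) = in_colour u v p))"

abbreviation colour_tuples :: "nat \<Rightarrow> (nat \<times> nat \<times> nat \<times> nat) set" where
  "colour_tuples N \<equiv> {..<N} \<times> {..<N} \<times> {..<N} \<times> {..<N}"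

definition edge_colours :: "(nat \<times> bool \<times> bool \<Rightarrow> nat) \<Rightarrow> nat \<Rightarrow> nat \<times> nat \<times> nat \<times> nat" where
  "edge_colours f i = (f (i, False, False), f (i, True, False), f (i, False, True), f (i, True, True))"

definition arc_colour :: "(nat \<Rightarrow> nat \<times> nat \<times> nat \<times> nat) \<Rightarrow> nat \<times> bool \<times> bool \<Rightarrow> nat" where
  "arc_colour \<alpha> = (\<lambda>(j, k, d). case \<alpha> j of (a1, a2, b1, b2) \<Rightarrow>
     if d then (if k then b2 else b1) else (if k then a2 else a1))"

lemma in_arcs_double_cycle: "(j, k, d) \<in> arcs (double_cycle n) \<longleftrightarrow> j < n"
  by (simp add: double_cycle_def)

lemma arc_colour_cong: "\<alpha> (fst a) = \<beta> (fst a) \<Longrightarrow> arc_colour \<alpha> a = arc_colour \<beta> a"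
  by (cases a) (simp add: arc_colour_def)

lemma arc_colour_edge_colours: "arc_colour (edge_colours f) = f"
  by (auto simp: arc_colour_def edge_colours_def fun_eq_iff)

lemma edge_colours_arc_colour: "edge_colours (arc_colour \<alpha>) i = \<alpha> i"
  by (cases "\<alpha> i") (simp add: arc_colour_def edge_colours_def)

lemma bij_betw_edge_colours:
  "bij_betw (\<lambda>f. \<lambda>i\<in>{..<n}. edge_colours f i)
     (arcs (double_cycle n) \<rightarrow>\<^sub>E {..<N}) ({..<n} \<rightarrow>\<^sub>E colour_tuples N)"
proof (rule bij_betw_byWitness[where f' = "\<lambda>\<alpha>. \<lambda>a\<in>arcs (double_cycle n). arc_colour \<alpha> a"])
  let ?A = "arcs (double_cycle n)"
  show "\<forall>f\<in>?A \<rightarrow>\<^sub>E {..<N}. (\<lambda>a\<in>?A. arc_colour (\<lambda>i\<in>{..<n}. edge_colours f i) a) = f"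
  proof
    fix f assume f: "f \<in> ?A \<rightarrow>\<^sub>E {..<N}"
    show "(\<lambda>a\<in>?A. arc_colour (\<lambda>i\<in>{..<n}. edge_colours f i) a) = f"
    proof
      fix a :: "nat \<times> bool \<times> bool"
      obtain j k d where a: "a = (j, k, d)" by (cases a)
      show "(\<lambda>a\<in>?A. arc_colour (\<lambda>i\<in>{..<n}. edge_colours f i) a) a = f a"
      proof (cases "a \<in> ?A")
        case True
        then have "arc_colour (\<lambda>i\<in>{..<n}. edge_colours f i) a = arc_colour (edge_colours f) a"
          by (intro arc_colour_cong) (simp add: a in_arcs_double_cycle)
        then show ?thesis using True by (simp add: arc_colour_edge_colours)
      next
        case False
        then show ?thesis using PiE_arb[OF f] by simp
      qed
    qed
  qed
  show "\<forall>\<alpha>\<in>{..<n} \<rightarrow>\<^sub>E colour_tuples N. (\<lambda>i\<in>{..<n}. edge_colours (\<lambda>a\<in>?A. arc_colour \<alpha> a) i) = \<alpha>"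
  proof
    fix \<alpha> assume \<alpha>: "\<alpha> \<in> {..<n} \<rightarrow>\<^sub>E colour_tuples N"
    show "(\<lambda>i\<in>{..<n}. edge_colours (\<lambda>a\<in>?A. arc_colour \<alpha> a) i) = \<alpha>"
    proof
      fix i
      show "(\<lambda>i\<in>{..<n}. edge_colours (\<lambda>a\<in>?A. arc_colour \<alpha> a) i) i = \<alpha> i"
      proof (cases "i < n")
        case True
        then have "edge_colours (\<lambda>a\<in>?A. arc_colour \<alpha> a) i = edge_colours (arc_colour \<alpha>) i"
          by (simp add: edge_colours_def in_arcs_double_cycle)
        then show ?thesis using True by (simp add: edge_colours_arc_colour)
      next
        case False
        then show ?thesis using PiE_arb[OF \<alpha>] by simp
      qed
    qed
  qed
  show "(\<lambda>f. \<lambda>i\<in>{..<n}. edge_colours f i) ` (?A \<rightarrow>\<^sub>E {..<N}) \<subseteq> {..<n} \<rightarrow>\<^sub>E colour_tuples N"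
  proof (rule image_subsetI)
    fix f assume f: "f \<in> ?A \<rightarrow>\<^sub>E {..<N}"
    have "f (i, k, d) < N" if "i < n" for i k d
      using PiE_mem[OF f, of "(i, k, d)"] that by (simp add: in_arcs_double_cycle)
    then show "(\<lambda>i\<in>{..<n}. edge_colours f i) \<in> {..<n} \<rightarrow>\<^sub>E colour_tuples N"
      by (intro restrict_PiE_iff[THEN iffD2]) (simp add: edge_colours_def)
  qed
  show "(\<lambda>\<alpha>. \<lambda>a\<in>?A. arc_colour \<alpha> a) ` ({..<n} \<rightarrow>\<^sub>E colour_tuples N) \<subseteq> ?A \<rightarrow>\<^sub>E {..<N}"
  proof (rule image_subsetI)
    fix \<alpha> assume \<alpha>: "\<alpha> \<in> {..<n} \<rightarrow>\<^sub>E colour_tuples N"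
    have "arc_colour \<alpha> a < N" if a: "a \<in> ?A" for a
    proof -
      obtain j k d where [simp]: "a = (j, k, d)" by (cases a)
      have "\<alpha> j \<in> colour_tuples N"
        using PiE_mem[OF \<alpha>, of j] a by (simp add: in_arcs_double_cycle)
      then show ?thesis by (cases "\<alpha> j") (simp add: arc_colour_def)
    qed
    then show "(\<lambda>a\<in>?A. arc_colour \<alpha> a) \<in> ?A \<rightarrow>\<^sub>E {..<N}"
      by (intro restrict_PiE_iff[THEN iffD2]) simp
  qed
qed

lemma out_colour_edge_colours:
  "out_colour (edge_colours f ((i + n - 1) mod n)) (edge_colours f i) p = f (vertex_end n i p)"
  by (cases p) (simp add: out_colour_def edge_colours_def vertex_end_def)

lemma in_colour_edge_colours:
  assumes "i < n"
  shows "in_colour (edge_colours f ((i + n - 1) mod n)) (edge_colours f i) p =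
    f (double_cycle_rev n (vertex_end n i p))"
  using assms
  by (cases p) (simp add: in_colour_def edge_colours_def vertex_end_def double_cycle_rev_def)

lemma of_bool_Ball_prod:
  fixes n :: nat
  shows "of_bool (\<forall>i<n. P i) = (\<Prod>i<n. of_bool (P i) :: nat)"
  by (induction n) (auto simp: less_Suc_eq)

text \<open>Double counting of pairs of a rotation system and a colouring constant along its faces.
  For a fixed colouring the condition splits into one per vertex, so summing over the local
  rotations yields a product of vertex weights.\<close>

lemma sum_power_card_faces:
  fixes N :: nat
  assumes "n > 0"
  shows "(\<Sum>\<sigma>\<in>rotation_systems (double_cycle n).
            N ^ card (faces (double_cycle n) (double_cycle_rev n) \<sigma>)) =
         (\<Sum>\<alpha>\<in>{..<n} \<rightarrow>\<^sub>E colour_tuples N.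
            \<Prod>i<n. vertex_weight (\<alpha> ((i + n - 1) mod n)) (\<alpha> i))"
proof -
  let ?A = "arcs (double_cycle n)" and ?rev = "double_cycle_rev n"
  let ?RS = "rotation_systems (double_cycle n)"
  let ?F = "?A \<rightarrow>\<^sub>E {..<N}"
  interpret bidirected_digraph "double_cycle n" ?rev
    by (rule bidirected_digraph_double_cycle)
  have finA: "finite ?A" by (simp add: double_cycle_def)
  have finF: "finite ?F" using finA by (intro finite_PiE) auto
  let ?ok = "\<lambda>f i \<tau>. \<forall>p. f (vertex_end n i (\<tau> p)) = f (?rev (vertex_end n i p))"
  have faces: "N ^ card (faces (double_cycle n) ?rev \<sigma>) =
      (\<Sum>f\<in>?F. of_bool (\<forall>i<n. \<forall>p. f (\<sigma> (vertex_end n i p)) = f (?rev (vertex_end n i p))))"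
    if "\<sigma> \<in> ?RS" for \<sigma>
  proof -
    have "\<sigma> \<circ> ?rev permutes ?A"
      using that arev_permutes_arcs by (intro permutes_compose) (auto simp: rotation_systems_def)
    from card_orbit_invariant_functions[OF finA this, of N]
    have "N ^ card (faces (double_cycle n) ?rev \<sigma>) =
        card {f \<in> ?F. \<forall>a\<in>?A. f (\<sigma> (?rev a)) = f a}"
      by (simp add: faces_def)
    \<comment> \<open>Replacing \<open>a\<close> by its reversal leaves \<open>\<sigma>\<close>
      applied to \<open>a\<close> itself, so the condition involves only the local rotation at the
      tail of \<open>a\<close>.\<close>
    also have "{f \<in> ?F. \<forall>a\<in>?A. f (\<sigma> (?rev a)) = f a} =
        {f \<in> ?F. \<forall>a\<in>?A. f (\<sigma> a) = f (?rev a)}"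
      by (intro Collect_cong conj_cong refl) (metis arev_arev arev_in_arcs)
    also have "card \<dots> = (\<Sum>f\<in>?F. of_bool (\<forall>a\<in>?A. f (\<sigma> a) = f (?rev a)))"
      using finF by (simp add: Int_def)
    also have "\<dots> = (\<Sum>f\<in>?F. of_bool (\<forall>i<n. \<forall>p. f (\<sigma> (vertex_end n i p)) = f (?rev (vertex_end n i p))))"
    proof -
      have "(\<forall>a\<in>?A. P a) \<longleftrightarrow> (\<forall>i<n. \<forall>p. P (vertex_end n i p))" for P
        unfolding arcs_double_cycle by blast
      then show ?thesis by (simp only:)
    qed
    finally show ?thesis .
  qed
  have "(\<Sum>\<sigma>\<in>?RS. N ^ card (faces (double_cycle n) ?rev \<sigma>)) =
      (\<Sum>\<sigma>\<in>?RS. \<Sum>f\<in>?F. of_bool (\<forall>i<n. \<forall>p. f (\<sigma> (vertex_end n i p)) = f (?rev (vertex_end n i p))))"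
    by (rule sum.cong[OF refl faces])
  also have "\<dots> = (\<Sum>T\<in>{..<n} \<rightarrow>\<^sub>E local_rotations. \<Sum>f\<in>?F.
      of_bool (\<forall>i<n. \<forall>p. f (rotation_of n T (vertex_end n i p)) = f (?rev (vertex_end n i p))))"
    by (rule sum.reindex_bij_betw[OF bij_betw_rotation_of, symmetric])
  also have "\<dots> = (\<Sum>T\<in>{..<n} \<rightarrow>\<^sub>E local_rotations. \<Sum>f\<in>?F. of_bool (\<forall>i<n. ?ok f i (T i)))"
  proof (intro sum.cong refl)
    fix T and f :: "nat \<times> bool \<times> bool \<Rightarrow> nat"
    have "(\<forall>i<n. \<forall>p. f (rotation_of n T (vertex_end n i p)) = f (?rev (vertex_end n i p))) \<longleftrightarrow>
        (\<forall>i<n. ?ok f i (T i))"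
      by (metis rotation_of_vertex_end)
    then show "of_bool (\<forall>i<n. \<forall>p. f (rotation_of n T (vertex_end n i p)) = f (?rev (vertex_end n i p))) =
        of_bool (\<forall>i<n. ?ok f i (T i))" by (simp only:)
  qed
  also have "\<dots> = (\<Sum>f\<in>?F. \<Sum>T\<in>{..<n} \<rightarrow>\<^sub>E local_rotations. \<Prod>i<n. of_bool (?ok f i (T i)))"
    by (subst sum.swap) (simp only: of_bool_Ball_prod)
  also have "\<dots> = (\<Sum>f\<in>?F. \<Prod>i<n. \<Sum>\<tau>\<in>local_rotations. of_bool (?ok f i \<tau>))"
    by (subst prod_sum_PiE) (simp_all only: finite_lessThan finite)
  also have "\<dots> = (\<Sum>\<alpha>\<in>{..<n} \<rightarrow>\<^sub>E colour_tuples N.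
            \<Prod>i<n. vertex_weight (\<alpha> ((i + n - 1) mod n)) (\<alpha> i))"
  proof (subst sum.reindex_bij_betw[OF bij_betw_edge_colours, symmetric], rule sum.cong[OF refl])
    fix f assume "f \<in> ?F"
    show "(\<Prod>i<n. \<Sum>\<tau>\<in>local_rotations. of_bool (?ok f i \<tau>)) =
      (\<Prod>i<n. vertex_weight ((\<lambda>i\<in>{..<n}. edge_colours f i) ((i + n - 1) mod n))
          ((\<lambda>i\<in>{..<n}. edge_colours f i) i))"
    proof (rule prod.cong[OF refl])
      fix i assume "i \<in> {..<n}"
      then have "i < n" "(i + n - 1) mod n < n" by auto
      then have "vertex_weight ((\<lambda>i\<in>{..<n}. edge_colours f i) ((i + n - 1) mod n))
          ((\<lambda>i\<in>{..<n}. edge_colours f i) i) =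
          vertex_weight (edge_colours f ((i + n - 1) mod n)) (edge_colours f i)" by simp
      also have "\<dots> = (\<Sum>\<tau>\<in>local_rotations. of_bool (?ok f i \<tau>))"
        unfolding vertex_weight_def out_colour_edge_colours in_colour_edge_colours[OF \<open>i < n\<close>] ..
      finally show "(\<Sum>\<tau>\<in>local_rotations. of_bool (?ok f i \<tau>)) =
          vertex_weight ((\<lambda>i\<in>{..<n}. edge_colours f i) ((i + n - 1) mod n))
          ((\<lambda>i\<in>{..<n}. edge_colours f i) i)" ..
    qed
  qed
  finally show ?thesis .
qed

section \<open>The six rotations at a vertex and the vertex weight\<close>

text \<open>A cycle written from the base point \<open>(False, False)\<close>, so that each cyclic
  order has exactly one such form. For distinct entries the last branch is the value at
  \<open>z\<close>.\<close>

definition four_cycle :: "bool \<times> bool \<Rightarrow> bool \<times> bool \<Rightarrow> bool \<times> bool \<Rightarrow> bool \<times> bool \<Rightarrow> bool \<times> bool" where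
  "four_cycle x y z p =
     (if p = (False, False) then x else if p = x then y else if p = y then z else (False, False))"

lemma UNIV_bool_prod:
  assumes "distinct [(False, False), x, y, z]"
  shows "UNIV = {(False, False), x, y, z}"
proof -
  have "card (UNIV :: (bool \<times> bool) set) = 4"
    by simp
  then have "card {(False, False), x, y, z} = card (UNIV :: (bool \<times> bool) set)"
    using assms by simp
  then show ?thesis
    by (intro card_subset_eq[symmetric] finite subset_UNIV)
qed

lemma cyclic_on_UNIV_closed:
  assumes "cyclic_on \<tau> UNIV" "x \<in> X" "\<And>y. y \<in> X \<Longrightarrow> \<tau> y \<in> X"
  shows "X = UNIV"
proof -
  have "y \<in> X" if "y \<in> orbit \<tau> x" for y
    using that by induction (use assms in auto)
  moreover have "orbit \<tau> x = UNIV"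
    using assms(1) by (simp add: orbit_cyclic_eq3)
  ultimately show ?thesis by blast
qed

text \<open>A cyclic permutation has no nonempty proper invariant subset, hence no cycle of length
  at most three on four points. So the first four iterates of \<open>(False, False)\<close> are
  distinct and the fifth returns to the start.\<close>

lemma cyclic_on_UNIV_iff_four_cycle:
  "cyclic_on \<tau> UNIV \<longleftrightarrow>
     (\<exists>x y z. distinct [(False, False), x, y, z] \<and> \<tau> = four_cycle x y z)"
proof
  assume cyc: "cyclic_on \<tau> UNIV"
  define q where "q = (False, False)"
  define x where "x = \<tau> q"
  define y where "y = \<tau> x"
  define z where "z = \<tau> y"
  have card4: "card (UNIV :: (bool \<times> bool) set) = 4"
    by simp
  have closed: False if "a \<in> X" "\<And>p. p \<in> X \<Longrightarrow> \<tau> p \<in> X" "card X \<le> 3" for a X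
  proof -
    have "X = UNIV" by (rule cyclic_on_UNIV_closed[OF cyc that(1,2)])
    then have "card X = 4" by (simp only: card4)
    then show False using that(3) by simp
  qed
  have no_short_cycle: "\<tau> a \<noteq> a" "\<not> (\<tau> a = b \<and> \<tau> b = a)"
    "\<not> (\<tau> a = b \<and> \<tau> b = c \<and> \<tau> c = a)" for a b c
  proof -
    note card = card_length[of "[a]"] card_length[of "[a, b]"] card_length[of "[a, b, c]"]
    show "\<tau> a \<noteq> a"
      by (rule notI, rule closed[of a "{a}"]) (use card in auto)
    show "\<not> (\<tau> a = b \<and> \<tau> b = a)"
      by (rule notI, rule closed[of a "{a, b}"]) (use card in auto)
    show "\<not> (\<tau> a = b \<and> \<tau> b = c \<and> \<tau> c = a)"
      by (rule notI, rule closed[of a "{a, b, c}"]) (use card in auto)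
  qed
  have v: "\<tau> q = x" "\<tau> x = y" "\<tau> y = z"
    by (simp_all add: x_def y_def z_def)
  have 1: "x \<noteq> q" "y \<noteq> x" "z \<noteq> y" "\<tau> z \<noteq> z"
    using no_short_cycle(1)[of q] no_short_cycle(1)[of x] no_short_cycle(1)[of y]
      no_short_cycle(1)[of z] v by auto
  have 2: "y \<noteq> q" "z \<noteq> x" "\<tau> z \<noteq> y"
    using no_short_cycle(2)[of q x] no_short_cycle(2)[of x y] no_short_cycle(2)[of y z] v by auto
  have 3: "z \<noteq> q" "\<tau> z \<noteq> x"
    using no_short_cycle(3)[of q x y] no_short_cycle(3)[of x y z] v by auto
  have d: "distinct [(False, False), x, y, z]"
    using 1 2 3 by (auto simp: q_def)
  note U = UNIV_bool_prod[OF d]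
  have all: "p \<in> {q, x, y, z}" for p
    unfolding q_def U[symmetric] by (rule UNIV_I)
  then have "\<tau> z = q"
    using all[of "\<tau> z"] 1 2 3 by simp
  have "four_cycle x y z q = x" "four_cycle x y z x = y" "four_cycle x y z y = z" "four_cycle x y z z = q"
    using 1 2 3 by (auto simp: four_cycle_def q_def)
  then have "\<tau> p = four_cycle x y z p" for p
    using all[of p] v \<open>\<tau> z = q\<close> by auto
  then show "\<exists>x y z. distinct [(False, False), x, y, z] \<and> \<tau> = four_cycle x y z"
    using d by blast
next
  assume "\<exists>x y z. distinct [(False, False), x, y, z] \<and> \<tau> = four_cycle x y z"
  then obtain x y z where d: "distinct [(False, False), x, y, z]" and \<tau>: "\<tau> = four_cycle x y z" by blast
  let ?q = "(False, False)"
  have v: "\<tau> ?q = x" "\<tau> x = y" "\<tau> y = z" "\<tau> z = ?q"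
    using d by (auto simp: \<tau> four_cycle_def)
  have x: "x \<in> orbit \<tau> ?q"
    using orbit.base[of \<tau> ?q] v(1) by simp
  have y: "y \<in> orbit \<tau> ?q"
    using orbit.step[OF x] v(2) by simp
  have z: "z \<in> orbit \<tau> ?q"
    using orbit.step[OF y] v(3) by simp
  have q: "?q \<in> orbit \<tau> ?q"
    using orbit.step[OF z] v(4) by simp
  have "UNIV \<subseteq> orbit \<tau> ?q"
    unfolding UNIV_bool_prod[OF d] using x y z q by blast
  then show "cyclic_on \<tau> UNIV"
    unfolding cyclic_on_def by (intro bexI[of _ ?q]) (auto intro: equalityI)
qed

lemma local_rotations_eq:
  "local_rotations = {
     four_cycle (False, True) (True, False) (True, True),
     four_cycle (True, False) (True, True) (False, True),
     four_cycle (False, True) (True, True) (True, False),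
     four_cycle (True, True) (True, False) (False, True),
     four_cycle (True, True) (False, True) (True, False),
     four_cycle (True, False) (False, True) (True, True)}" (is "_ = ?S")
proof (intro equalityI subsetI)
  fix \<tau> assume "\<tau> \<in> local_rotations"
  then obtain x y z where d: "distinct [(False, False), x, y, z]" and \<tau>: "\<tau> = four_cycle x y z"
    unfolding local_rotations_def mem_Collect_eq cyclic_on_UNIV_iff_four_cycle by blast
  obtain x1 x2 y1 y2 z1 z2 where xyz: "x = (x1, x2)" "y = (y1, y2)" "z = (z1, z2)"
    by (metis surj_pair)
  show "\<tau> \<in> ?S"
    using d unfolding \<tau> xyz
    by (cases x1; cases x2; cases y1; cases y2; cases z1; cases z2; simp)
next
  have four_cycle: "four_cycle x y z \<in> local_rotations" if "distinct [(False, False), x, y, z]" for x y z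
    using that unfolding local_rotations_def mem_Collect_eq cyclic_on_UNIV_iff_four_cycle by blast
  fix \<tau> assume "\<tau> \<in> ?S"
  then show "\<tau> \<in> local_rotations"
    by (elim insertE emptyE) (simp_all only:, simp_all add: four_cycle)
qed

text \<open>Ensures that the six rotations listed in \<open>local_rotations_eq\<close> are distinct,
  so that the sum over the set really has six terms.\<close>

lemma four_cycle_eq_iff:
  assumes "distinct [(False, False), x, y, z]" "distinct [(False, False), x', y', z']"
  shows "four_cycle x y z = four_cycle x' y' z' \<longleftrightarrow> x = x' \<and> y = y' \<and> z = z'"
proof
  have v: "four_cycle x y z (False, False) = x" "four_cycle x y z x = y" "four_cycle x y z y = z"
    if "distinct [(False, False), x, y, z]" for x y z
    using that by (auto simp: four_cycle_def)
  assume eq: "four_cycle x y z = four_cycle x' y' z'"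
  have "x = x'"
    using fun_cong[OF eq, of "(False, False)"] v(1)[OF assms(1)] v(1)[OF assms(2)] by simp
  moreover have "y = y'"
    using fun_cong[OF eq, of x] v(2)[OF assms(1)] v(2)[OF assms(2)] \<open>x = x'\<close> by simp
  moreover have "z = z'"
    using fun_cong[OF eq, of y] v(3)[OF assms(1)] v(3)[OF assms(2)] \<open>y = y'\<close> by simp
  ultimately show "x = x' \<and> y = y' \<and> z = z'" by simp
qed simp

lemma sum_local_rotations:
  "sum f local_rotations =
     f (four_cycle (False, True) (True, False) (True, True)) +
     f (four_cycle (True, False) (True, True) (False, True)) +
     f (four_cycle (False, True) (True, True) (True, False)) +
     f (four_cycle (True, True) (True, False) (False, True)) +
     f (four_cycle (True, True) (False, True) (True, False)) +
     f (four_cycle (True, False) (False, True) (True, True))"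
  unfolding local_rotations_eq by (simp add: four_cycle_eq_iff add.assoc)

text \<open>The first four rotations each impose one equation within the first tuple and one within
  the second, where strands bounce, and pass one colour in each direction; they become
  \<open>K_op\<close> after \<open>H_op\<close>. In the last two the first tuple determines the
  second by a swap; they become \<open>B_op\<close>.\<close>

lemma vertex_weight_eq:
  "vertex_weight (a1, a2, b1, b2) (c1, c2, d1, d2) =
     of_bool (b2 = a1 \<and> c1 = a2 \<and> c2 = d1 \<and> d2 = b1) +
     of_bool (b2 = a1 \<and> c2 = a2 \<and> c1 = d2 \<and> d1 = b1) +
     of_bool (b1 = a2 \<and> c1 = a1 \<and> c2 = d1 \<and> d2 = b2) +
     of_bool (b1 = a2 \<and> c2 = a1 \<and> c1 = d2 \<and> d1 = b2) +
     of_bool (c1 = a1 \<and> d1 = b2 \<and> c2 = a2 \<and> d2 = b1) +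
     of_bool (c2 = a1 \<and> d2 = b2 \<and> c1 = a2 \<and> d1 = b1)"
proof -
  note rules = four_cycle_def out_colour_def in_colour_def all_bool_eq
  let ?ok = "\<lambda>\<tau>. \<forall>p. out_colour (a1, a2, b1, b2) (c1, c2, d1, d2) (\<tau> p) =
    in_colour (a1, a2, b1, b2) (c1, c2, d1, d2) p"
  have 1: "?ok (four_cycle (False, True) (True, False) (True, True)) \<longleftrightarrow>
      b2 = a1 \<and> c1 = a2 \<and> c2 = d1 \<and> d2 = b1" unfolding split_paired_All all_bool_eq by (simp add: rules) auto
  have 2: "?ok (four_cycle (True, False) (True, True) (False, True)) \<longleftrightarrow>
      b2 = a1 \<and> c2 = a2 \<and> c1 = d2 \<and> d1 = b1" unfolding split_paired_All all_bool_eq by (simp add: rules) auto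
  have 3: "?ok (four_cycle (False, True) (True, True) (True, False)) \<longleftrightarrow>
      b1 = a2 \<and> c1 = a1 \<and> c2 = d1 \<and> d2 = b2" unfolding split_paired_All all_bool_eq by (simp add: rules) auto
  have 4: "?ok (four_cycle (True, True) (True, False) (False, True)) \<longleftrightarrow>
      b1 = a2 \<and> c2 = a1 \<and> c1 = d2 \<and> d1 = b2" unfolding split_paired_All all_bool_eq by (simp add: rules) auto
  have 5: "?ok (four_cycle (True, True) (False, True) (True, False)) \<longleftrightarrow>
      c1 = a1 \<and> d1 = b2 \<and> c2 = a2 \<and> d2 = b1" unfolding split_paired_All all_bool_eq by (simp add: rules) auto
  have 6: "?ok (four_cycle (True, False) (False, True) (True, True)) \<longleftrightarrow>
      c2 = a1 \<and> d2 = b2 \<and> c1 = a2 \<and> d1 = b1" unfolding split_paired_All all_bool_eq by (simp add: rules) auto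
  show ?thesis
    unfolding vertex_weight_def sum_local_rotations 1 2 3 4 5 6 by (rule refl)
qed

section \<open>The transfer operator and its trace\<close>

text \<open>Here \<open>u\<close> is the colour passing forward, \<open>v\<close> the one passing
  backward, and \<open>w\<close> the free colour of the bouncing strand on the next double edge; the
  two terms differ in which parallel edge carries \<open>u\<close>.\<close>

definition H_op :: "nat \<Rightarrow> (nat \<times> nat \<times> nat \<times> nat \<Rightarrow> 'a) \<Rightarrow> nat \<times> nat \<Rightarrow> 'a::comm_ring_1" where
  "H_op N f = (\<lambda>(u, v). \<Sum>w<N. f (u, w, w, v) + f (w, u, v, w))"

definition K_op :: "(nat \<times> nat \<Rightarrow> 'a) \<Rightarrow> nat \<times> nat \<times> nat \<times> nat \<Rightarrow> 'a::comm_ring_1" where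
  "K_op h = (\<lambda>(a1, a2, b1, b2). (if b2 = a1 then h (a2, b1) else 0) + (if b1 = a2 then h (a1, b2) else 0))"

definition B_op :: "(nat \<times> nat \<times> nat \<times> nat \<Rightarrow> 'a) \<Rightarrow> nat \<times> nat \<times> nat \<times> nat \<Rightarrow> 'a::comm_ring_1" where
  "B_op f = (\<lambda>(a1, a2, b1, b2). f (a1, a2, b2, b1) + f (a2, a1, b1, b2))"

text \<open>For \<open>N > 0\<close> this is \<open>N\<close> times a projection onto the line
  spanned by the indicator of the diagonal.\<close>

definition J_op :: "nat \<Rightarrow> (nat \<times> nat \<Rightarrow> 'a) \<Rightarrow> nat \<times> nat \<Rightarrow> 'a::comm_ring_1" where
  "J_op N h = (\<lambda>(u, v). if u = v then \<Sum>w<N. h (w, w) else 0)"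

definition delta :: "'b \<Rightarrow> 'b \<Rightarrow> 'a::comm_ring_1" where
  "delta u v = (if v = u then 1 else 0)"

lemma H_K: "H_op N (K_op h) p = 2 * (of_nat N * h p + J_op N h p)"
  by (cases p) (auto simp: H_op_def K_op_def J_op_def sum.distrib algebra_simps simp flip: sum_distrib_left)

text \<open>After the swap every one of the eight terms forces the summation colour \<open>w\<close>
  to be \<open>u\<close> or \<open>v\<close>, so no factor \<open>N\<close> appears. The assumption
  guarantees that the forced colour lies in the summation range.\<close>

lemma H_B_K:
  assumes "p \<in> {..<N} \<times> {..<N}"
  shows "H_op N (B_op (K_op h)) p = 8 * h p"
  using assms by (cases p) (auto simp: H_op_def K_op_def B_op_def sum.distrib simp flip: sum_distrib_left)

text \<open>\<open>B_op\<close> is the sum of two commuting involutions, the swaps of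
  \<open>b1, b2\<close> and of \<open>a1, a2\<close>; their product exchanges the two parallel
  edges. So its square is twice the identity plus twice this exchange. The values of
  \<open>H_op\<close> and \<open>K_op\<close> are unaffected by the exchange, and
  \<open>B_op\<close> absorbs it; hence the factor \<open>4\<close> here and in the next two
  lemmas.\<close>

lemma H_B_B: "H_op N (B_op (B_op f)) = (\<lambda>p. 4 * H_op N f p)"
  by (auto simp: H_op_def B_op_def fun_eq_iff sum.distrib algebra_simps simp flip: sum_distrib_left)

lemma B_B_K: "B_op (B_op (K_op h)) = (\<lambda>u. 4 * K_op h u)"
  by (auto simp: K_op_def B_op_def fun_eq_iff)

lemma B_B_B: "B_op (B_op (B_op f)) = (\<lambda>u. 4 * B_op f u)"
  by (auto simp: B_op_def fun_eq_iff)

lemma J_J: "J_op N (J_op N h) = (\<lambda>p. of_nat N * J_op N h p)"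
  by (auto simp: J_op_def fun_eq_iff)

lemma sum_if_const: "(\<Sum>x\<in>A. if P then f x else 0) = (if P then sum f A else (0::'a::comm_ring_1))"
  by simp

lemma mult_if_zero: "a * (if P then b else 0) = (if P then a * b else (0::'a::comm_ring_1))"
  by simp

lemma if_add_zero: "(if P then a + b else 0) = (if P then a else 0) + (if P then b else (0::'a::comm_ring_1))"
  by simp

lemma if_conj: "(if P \<and> Q then x else (0::'a::comm_ring_1)) = (if P then if Q then x else 0 else 0)"
  by simp

lemma sum_colour_tuples:
  "sum f (colour_tuples N) = (\<Sum>a1<N. \<Sum>a2<N. \<Sum>b1<N. \<Sum>b2<N. f (a1, a2, b1, b2))"
  by (simp add: sum.cartesian_product' )

text \<open>By \<open>delta_def\<close> a trace counts the colour tuples satisfying systems of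
  equations. With the conjunctions split into nested conditionals every sum over a forced colour
  collapses, and each free colour leaves a factor \<open>N\<close>.\<close>

lemmas trace_rules = K_op_def H_op_def B_op_def J_op_def delta_def sum_colour_tuples if_conj
  sum_if_const sum.distrib mult_if_zero if_add_zero

lemma trace_B: "(\<Sum>u\<in>colour_tuples N. B_op (delta u) u) = (2 * of_nat N ^ 3 :: 'a::comm_ring_1)"
  by (simp add: trace_rules power3_eq_cube algebra_simps cong: if_cong)

lemma trace_BB: "(\<Sum>u\<in>colour_tuples N. B_op (B_op (delta u)) u) = (2 * (of_nat N ^ 4 + of_nat N ^ 2) :: 'a::comm_ring_1)"
  by (simp add: trace_rules power4_eq_xxxx power2_eq_square algebra_simps cong: if_cong)

lemma trace_KH: "(\<Sum>u\<in>colour_tuples N. K_op (H_op N (delta u)) u) = (2 * of_nat N ^ 3 + 2 * of_nat N :: 'a::comm_ring_1)"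
  by (simp add: trace_rules power3_eq_cube algebra_simps cong: if_cong)

lemma trace_KHB: "(\<Sum>u\<in>colour_tuples N. K_op (H_op N (B_op (delta u))) u) = (8 * of_nat N ^ 2 :: 'a::comm_ring_1)"
  by (simp add: trace_rules power2_eq_square algebra_simps cong: if_cong)

lemma trace_BKH: "(\<Sum>u\<in>colour_tuples N. B_op (K_op (H_op N (delta u))) u) = (8 * of_nat N ^ 2 :: 'a::comm_ring_1)"
  by (simp add: trace_rules power2_eq_square algebra_simps cong: if_cong)

lemma trace_KJH: "(\<Sum>u\<in>colour_tuples N. K_op (J_op N (H_op N (delta u))) u) = (4 * of_nat N ^ 2 :: 'a::comm_ring_1)"
  by (simp add: trace_rules power2_eq_square algebra_simps cong: if_cong)

lemma trace_BKHB: "(\<Sum>u\<in>colour_tuples N. B_op (K_op (H_op N (B_op (delta u)))) u) = (8 * of_nat N ^ 3 + 8 * of_nat N :: 'a::comm_ring_1)"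
  by (simp add: trace_rules power3_eq_cube algebra_simps cong: if_cong)

lemma trace_KJHB: "(\<Sum>u\<in>colour_tuples N. K_op (J_op N (H_op N (B_op (delta u)))) u) = (8 * of_nat N :: 'a::comm_ring_1)"
  by (simp add: trace_rules power2_eq_square algebra_simps cong: if_cong)

lemma trace_BKJH: "(\<Sum>u\<in>colour_tuples N. B_op (K_op (J_op N (H_op N (delta u)))) u) = (8 * of_nat N :: 'a::comm_ring_1)"
  by (simp add: trace_rules power2_eq_square algebra_simps cong: if_cong)

lemma trace_BKJHB: "(\<Sum>u\<in>colour_tuples N. B_op (K_op (J_op N (H_op N (B_op (delta u))))) u) = (16 * of_nat N ^ 2 :: 'a::comm_ring_1)"
  by (simp add: trace_rules power2_eq_square algebra_simps cong: if_cong)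

section \<open>The transfer operator and closed walks\<close>

definition transfer ::
    "nat \<Rightarrow> (nat \<times> nat \<times> nat \<times> nat \<Rightarrow> 'a) \<Rightarrow> nat \<times> nat \<times> nat \<times> nat \<Rightarrow> 'a::comm_ring_1" where
  "transfer N f u = (\<Sum>v\<in>colour_tuples N. of_nat (vertex_weight u v) * f v)"

lemma sum_PiE_lessThan_Suc:
  fixes F :: "(nat \<Rightarrow> 'b) \<Rightarrow> 'a::comm_monoid_add"
  assumes "finite V"
  shows "(\<Sum>\<alpha>\<in>{..<Suc n} \<rightarrow>\<^sub>E V. F \<alpha>) = (\<Sum>\<alpha>\<in>{..<n} \<rightarrow>\<^sub>E V. \<Sum>y\<in>V. F (\<alpha>(n := y)))"
proof -
  have inj: "inj_on (\<lambda>(y, g). g(n := y)) (V \<times> ({..<n} \<rightarrow>\<^sub>E V))"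
    using inj_combinator[of n "{..<n}" "\<lambda>_. V"] by simp
  have "(\<Sum>\<alpha>\<in>{..<Suc n} \<rightarrow>\<^sub>E V. F \<alpha>) = (\<Sum>(y, \<alpha>)\<in>V \<times> ({..<n} \<rightarrow>\<^sub>E V). F (\<alpha>(n := y)))"
    unfolding lessThan_Suc PiE_insert_eq sum.reindex[OF inj] by (simp add: case_prod_unfold)
  also have "\<dots> = (\<Sum>y\<in>V. \<Sum>\<alpha>\<in>{..<n} \<rightarrow>\<^sub>E V. F (\<alpha>(n := y)))"
    by (rule sum.cartesian_product[symmetric])
  finally show ?thesis by (simp only: sum.swap[of _ V])
qed

text \<open>A power of a kernel operator sums over walks. The starting point \<open>u\<close> is not
  part of \<open>\<alpha>\<close> and plays the role of an entry at index \<open>-1\<close>, hence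
  the case distinctions at \<open>0\<close>.\<close>

lemma sum_PiE_path:
  fixes w :: "'b \<Rightarrow> 'b \<Rightarrow> 'a::comm_ring_1"
  assumes "finite V"
  shows "(\<Sum>\<alpha>\<in>{..<n} \<rightarrow>\<^sub>E V. (\<Prod>i<n. w (if i = 0 then u else \<alpha> (i - 1)) (\<alpha> i)) *
      f (if n = 0 then u else \<alpha> (n - 1))) = ((\<lambda>f u. \<Sum>v\<in>V. w u v * f v) ^^ n) f u"
proof (induction n arbitrary: f)
  case 0
  then show ?case by simp
next
  case (Suc n)
  let ?T = "\<lambda>f u. \<Sum>v\<in>V. w u v * f v"
  have prod_upd: "(\<Prod>i<n. w (if i = 0 then u else (\<alpha>(n := y)) (i - 1)) ((\<alpha>(n := y)) i)) =
      (\<Prod>i<n. w (if i = 0 then u else \<alpha> (i - 1)) (\<alpha> i))" for \<alpha> y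
    by (intro prod.cong) auto
  have "(\<Sum>\<alpha>\<in>{..<Suc n} \<rightarrow>\<^sub>E V. (\<Prod>i<Suc n. w (if i = 0 then u else \<alpha> (i - 1)) (\<alpha> i)) *
      f (if Suc n = 0 then u else \<alpha> (Suc n - 1))) =
      (\<Sum>\<alpha>\<in>{..<n} \<rightarrow>\<^sub>E V. \<Sum>y\<in>V. (\<Prod>i<n. w (if i = 0 then u else \<alpha> (i - 1)) (\<alpha> i)) *
        (w (if n = 0 then u else \<alpha> (n - 1)) y * f y))"
    unfolding sum_PiE_lessThan_Suc[OF assms] prod.lessThan_Suc prod_upd
    by (intro sum.cong refl; cases n; simp add: mult.assoc)
  also have "\<dots> = (?T ^^ n) (?T f) u"
    unfolding Suc.IH[of "?T f", symmetric] by (simp only: sum_distrib_left)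
  also have "\<dots> = (?T ^^ Suc n) f u"
    by (simp only: funpow_Suc_right o_apply)
  finally show ?case .
qed

text \<open>Taking \<open>f = delta u\<close> forces the last entry of the walk to be
  \<open>u\<close>, which closes it.\<close>

lemma sum_PiE_cycle:
  fixes w :: "'b \<Rightarrow> 'b \<Rightarrow> 'a::comm_ring_1"
  assumes "finite V" "n > 0"
  shows "(\<Sum>\<alpha>\<in>{..<n} \<rightarrow>\<^sub>E V. \<Prod>i<n. w (\<alpha> ((i + n - 1) mod n)) (\<alpha> i)) =
    (\<Sum>u\<in>V. ((\<lambda>f u. \<Sum>v\<in>V. w u v * f v) ^^ n) (delta u) u)"
proof -
  have "(\<Sum>u\<in>V. ((\<lambda>f u. \<Sum>v\<in>V. w u v * f v) ^^ n) (delta u) u) =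
      (\<Sum>\<alpha>\<in>{..<n} \<rightarrow>\<^sub>E V. \<Sum>u\<in>V. (\<Prod>i<n. w (if i = 0 then u else \<alpha> (i - 1)) (\<alpha> i)) *
      delta u (if n = 0 then u else \<alpha> (n - 1)))"
    unfolding sum_PiE_path[OF assms(1), symmetric] by (rule sum.swap)
  also have "\<dots> = (\<Sum>\<alpha>\<in>{..<n} \<rightarrow>\<^sub>E V. \<Prod>i<n. w (\<alpha> ((i + n - 1) mod n)) (\<alpha> i))"
  proof (rule sum.cong[OF refl])
    fix \<alpha> assume \<alpha>: "\<alpha> \<in> {..<n} \<rightarrow>\<^sub>E V"
    have last: "\<alpha> (n - 1) \<in> V"
      using PiE_mem[OF \<alpha>, of "n - 1"] assms by simp
    have "(\<Sum>u\<in>V. (\<Prod>i<n. w (if i = 0 then u else \<alpha> (i - 1)) (\<alpha> i)) *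
        delta u (if n = 0 then u else \<alpha> (n - 1))) =
      (\<Sum>u\<in>V. if \<alpha> (n - 1) = u then \<Prod>i<n. w (if i = 0 then u else \<alpha> (i - 1)) (\<alpha> i) else 0)"
      using assms(2) by (intro sum.cong) (auto simp: delta_def)
    also have "\<dots> = (\<Prod>i<n. w (if i = 0 then \<alpha> (n - 1) else \<alpha> (i - 1)) (\<alpha> i))"
      by (simp only: sum.delta'[OF assms(1)] last if_True)
    also have "\<dots> = (\<Prod>i<n. w (\<alpha> ((i + n - 1) mod n)) (\<alpha> i))"
    proof (rule prod.cong[OF refl])
      fix i assume "i \<in> {..<n}"
      then show "w (if i = 0 then \<alpha> (n - 1) else \<alpha> (i - 1)) (\<alpha> i) = w (\<alpha> ((i + n - 1) mod n)) (\<alpha> i)"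
        by (cases i) auto
    qed
    finally show "(\<Sum>u\<in>V. (\<Prod>i<n. w (if i = 0 then u else \<alpha> (i - 1)) (\<alpha> i)) *
        delta u (if n = 0 then u else \<alpha> (n - 1))) = (\<Prod>i<n. w (\<alpha> ((i + n - 1) mod n)) (\<alpha> i))" .
  qed
  finally show ?thesis ..
qed

lemma of_nat_of_bool_mult: "of_nat (of_bool P) * x = (if P then x else (0::'a::comm_ring_1))"
  by simp

text \<open>The assumption puts the colours forced by \<open>u\<close> into the summation range of
  \<open>transfer\<close>; \<open>K_op\<close> and \<open>B_op\<close> know no such range.\<close>

lemma transfer_eq:
  assumes "u \<in> colour_tuples N"
  shows "transfer N f u = K_op (H_op N f) u + B_op f u"
proof -
  obtain a1 a2 b1 b2 where u: "u = (a1, a2, b1, b2)" by (cases u)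
  have less: "a1 < N" "a2 < N" "b1 < N" "b2 < N" using assms u by auto
  have sum_less: "(\<Sum>x<N. if x = a then g x else 0) = g a" if "a < N" for a and g :: "nat \<Rightarrow> 'a"
    using that by simp
  have "transfer N f u = (\<Sum>c1<N. \<Sum>c2<N. \<Sum>d1<N. \<Sum>d2<N.
      of_nat (vertex_weight (a1, a2, b1, b2) (c1, c2, d1, d2)) * f (c1, c2, d1, d2))"
    by (simp only: transfer_def u sum_colour_tuples)
  also have "\<dots> = (if b2 = a1 then \<Sum>w<N. f (a2, w, w, b1) else 0) +
     (if b2 = a1 then \<Sum>w<N. f (w, a2, b1, w) else 0) +
     (if b1 = a2 then \<Sum>w<N. f (a1, w, w, b2) else 0) +
     (if b1 = a2 then \<Sum>w<N. f (w, a1, b2, w) else 0) +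
     f (a1, a2, b2, b1) + f (a2, a1, b1, b2)"
    using less
    by (simp add: vertex_weight_eq distrib_right sum.distrib of_nat_of_bool_mult if_conj sum_if_const
        sum_less cong: if_cong del: of_nat_of_bool)
  finally show ?thesis
    by (simp add: u K_op_def H_op_def B_op_def sum.distrib)
qed

text \<open>Since \<open>transfer_eq\<close> and \<open>H_B_K\<close> hold only for colours below
  \<open>N\<close>, rewriting under the operators needs congruence rules restricted to these
  colours.\<close>

lemma H_op_cong:
  assumes "p \<in> {..<N} \<times> {..<N}" "\<And>u. u \<in> colour_tuples N \<Longrightarrow> f u = g u"
  shows "H_op N f p = H_op N g p"
  using assms by (cases p) (auto simp: H_op_def intro!: sum.cong)

lemma K_op_cong:
  assumes "u \<in> colour_tuples N" "\<And>p. p \<in> {..<N} \<times> {..<N} \<Longrightarrow> f p = g p"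
  shows "K_op f u = K_op g u"
  using assms by (cases u) (auto simp: K_op_def)

lemma B_op_cong:
  assumes "u \<in> colour_tuples N" "\<And>u. u \<in> colour_tuples N \<Longrightarrow> f u = g u"
  shows "B_op f u = B_op g u"
  using assms by (cases u) (auto simp: B_op_def)

lemma H_op_linear: "H_op N (\<lambda>u. f u + g u) p = H_op N f p + H_op N g p"
    "H_op N (\<lambda>u. c * f u) p = c * H_op N f p"
  by (cases p; auto simp: H_op_def sum.distrib sum_distrib_left algebra_simps)+

lemma K_op_linear: "K_op (\<lambda>u. f u + g u) p = K_op f p + K_op g p"
    "K_op (\<lambda>u. c * f u) p = c * K_op f p"
  by (cases p; auto simp: K_op_def algebra_simps)+

lemma B_op_linear: "B_op (\<lambda>u. f u + g u) p = B_op f p + B_op g p"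
    "B_op (\<lambda>u. c * f u) p = c * B_op f p"
  by (cases p; auto simp: B_op_def algebra_simps)+

lemma J_op_linear: "J_op N (\<lambda>u. f u + g u) p = J_op N f p + J_op N g p"
    "J_op N (\<lambda>u. c * f u) p = c * J_op N f p"
  by (cases p; auto simp: J_op_def sum.distrib sum_distrib_left)+

context
  fixes N :: nat and f :: "nat \<times> nat \<times> nat \<times> nat \<Rightarrow> 'a::field_char_0"
begin

text \<open>The two components are the \<open>g\<close> and \<open>g'\<close> in the correction
  \<open>K g + (1/2) B K g'\<close> to the power of \<open>B_op\<close>. One more step yields
  \<open>2 (N + J) g\<close> by \<open>H_K\<close>; the \<open>6\<close> is \<open>4\<close> from
  \<open>H_B_K\<close> plus \<open>2\<close> from \<open>B_B_K\<close>, both already halved.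
  Applying \<open>B_op\<close> to \<open>K g\<close> gives the new second component
  \<open>2 g\<close>.\<close>

primrec transfer_coeffs :: "nat \<Rightarrow> (nat \<times> nat \<Rightarrow> 'a) \<times> (nat \<times> nat \<Rightarrow> 'a)" where
  "transfer_coeffs 0 = (\<lambda>p. 0, \<lambda>p. 0)"
| "transfer_coeffs (Suc n) = (let (g, g') = transfer_coeffs n in
     (\<lambda>p. 2 * (of_nat N * g p + J_op N g p) + 6 * g' p + H_op N ((B_op ^^ n) f) p, \<lambda>p. 2 * g p))"

lemma transfer_funpow:
  assumes "u \<in> colour_tuples N"
  shows "(transfer N ^^ n) f u = (B_op ^^ n) f u + K_op (fst (transfer_coeffs n)) u +
    (1 / 2) * B_op (K_op (snd (transfer_coeffs n))) u"
  using assms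
proof (induction n arbitrary: u)
  case 0
  then show ?case by (cases u) (simp add: K_op_def B_op_def)
next
  case (Suc n)
  obtain g g' where g: "transfer_coeffs n = (g, g')" by fastforce
  let ?R = "\<lambda>u. (B_op ^^ n) f u + K_op g u + (1 / 2) * B_op (K_op g') u"
  have IH: "(transfer N ^^ n) f u = ?R u" if "u \<in> colour_tuples N" for u
    using Suc.IH[OF that] g by simp
  have "(transfer N ^^ Suc n) f u = K_op (H_op N ((transfer N ^^ n) f)) u + B_op ((transfer N ^^ n) f) u"
    using transfer_eq[OF Suc.prems] by simp
  also have "B_op ((transfer N ^^ n) f) u = B_op ?R u"
    by (rule B_op_cong[OF Suc.prems IH])
  also have "\<dots> = (B_op ^^ Suc n) f u + B_op (K_op g) u + 2 * K_op g' u"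
    unfolding B_op_linear B_B_K by simp
  also have "K_op (H_op N ((transfer N ^^ n) f)) u =
      K_op (\<lambda>p. H_op N ((B_op ^^ n) f) p + 2 * (of_nat N * g p + J_op N g p) + 4 * g' p) u"
  proof (rule K_op_cong[OF Suc.prems])
    fix p assume p: "p \<in> {..<N} \<times> {..<N}"
    have "H_op N ((transfer N ^^ n) f) p = H_op N ?R p"
      by (rule H_op_cong[OF p IH])
    also have "\<dots> = H_op N ((B_op ^^ n) f) p + 2 * (of_nat N * g p + J_op N g p) + 4 * g' p"
      unfolding H_op_linear H_K H_B_K[OF p] by simp
    finally show "H_op N ((transfer N ^^ n) f) p = \<dots>" .
  qed
  also have "\<dots> = K_op (fst (transfer_coeffs (Suc n))) u - 2 * K_op g' u"
    by (cases u) (simp add: g K_op_def)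
  also have "B_op (K_op g) u = (1 / 2) * B_op (K_op (snd (transfer_coeffs (Suc n)))) u"
    by (cases u) (simp add: g K_op_def B_op_def algebra_simps)
  finally show ?case by simp
qed

lemma B_op_funpow_Suc3: "(B_op ^^ Suc (Suc (Suc n))) f = (\<lambda>u. 4 * (B_op ^^ Suc n) f u)"
  by (simp add: B_B_B)

lemma H_op_B_op_funpow:
  "H_op N ((B_op ^^ n) f) p = 2 ^ n * (if even n then H_op N f p else (1 / 2) * H_op N (B_op f) p)"
proof (induction n rule: induct_nat_012)
  case (ge2 n)
  then show ?case by (simp add: H_B_B)
qed simp_all

end

text \<open>On the image of \<open>J_op\<close>, which acts there as multiplication by \<open>N\<close>, and on its kernel the
  recursion of \<open>transfer_coeffs\<close> is the recursion below with \<open>q = 4 N\<close> and \<open>q = 2 N\<close>;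
  \<open>j\<close> indexes the source terms \<open>H f\<close> and \<open>H (B f) / 2\<close>.\<close>

primrec scalar_coeffs :: "'a::comm_ring_1 \<Rightarrow> nat \<Rightarrow> nat \<Rightarrow> 'a \<times> 'a" where
  "scalar_coeffs q j 0 = (0, 0)"
| "scalar_coeffs q j (Suc n) = (let (x, x') = scalar_coeffs q j n in
     (q * x + 6 * x' + (if n mod 2 = j then 2 ^ n else 0), 2 * x))"

text \<open>Each source term \<open>h\<close> splits as \<open>(h - J h / N) + J h / N\<close>. The
  first part evolves with the coefficients \<open>c\<close>, the second with \<open>d\<close>, which
  leaves \<open>c\<close> in front of \<open>h\<close> and \<open>(d - c) / N\<close> in front of
  \<open>J h\<close>.\<close>

lemma transfer_coeffs_eq:
  fixes f :: "nat \<times> nat \<times> nat \<times> nat \<Rightarrow> 'a::field_char_0"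
  assumes N: "N > 0"
  defines "c \<equiv> scalar_coeffs (2 * of_nat N)" and "d \<equiv> scalar_coeffs (4 * of_nat N)"
  shows
  "fst (transfer_coeffs N f n) p =
     fst (c 0 n) * H_op N f p + fst (c 1 n) / 2 * H_op N (B_op f) p +
     (fst (d 0 n) - fst (c 0 n)) / of_nat N * J_op N (H_op N f) p +
     (fst (d 1 n) - fst (c 1 n)) / of_nat N / 2 * J_op N (H_op N (B_op f)) p \<and>
   snd (transfer_coeffs N f n) p =
     snd (c 0 n) * H_op N f p + snd (c 1 n) / 2 * H_op N (B_op f) p +
     (snd (d 0 n) - snd (c 0 n)) / of_nat N * J_op N (H_op N f) p +
     (snd (d 1 n) - snd (c 1 n)) / of_nat N / 2 * J_op N (H_op N (B_op f)) p"
proof (induction n arbitrary: p)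
  case 0
  then show ?case by (simp add: c_def d_def)
next
  case (Suc n)
  let ?N = "of_nat N :: 'a"
  have N0: "?N \<noteq> 0" using N by simp
  have parity: "(n mod 2 = 0) = even n" "(n mod 2 = Suc 0) = odd n"
    by presburger+
  obtain g g' where g: "transfer_coeffs N f n = (g, g')" by fastforce
  obtain x0 x0' x1 x1' y0 y0' y1 y1' where xy: "c 0 n = (x0, x0')" "c 1 n = (x1, x1')"
      "d 0 n = (y0, y0')" "d 1 n = (y1, y1')" by (metis surj_pair)
  \<comment> \<open>With these quotients \<open>y = x + N * e\<close>, so the step can be verified
    without divisions by \<open>N\<close>.\<close>
  define e0 e0' e1 e1' where "e0 = (y0 - x0) / ?N" and "e0' = (y0' - x0') / ?N"
    and "e1 = (y1 - x1) / ?N" and "e1' = (y1' - x1') / ?N"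
  note e = this
  have y: "y0 = x0 + ?N * e0" "y0' = x0' + ?N * e0'" "y1 = x1 + ?N * e1" "y1' = x1' + ?N * e1'"
    using N0 by (simp_all add: e)
  have Suc_c: "c 0 (Suc n) = (2 * ?N * x0 + 6 * x0' + (if even n then 2 ^ n else 0), 2 * x0)"
      "c 1 (Suc n) = (2 * ?N * x1 + 6 * x1' + (if odd n then 2 ^ n else 0), 2 * x1)"
    using xy by (simp_all add: c_def parity)
  have Suc_d: "d 0 (Suc n) = (4 * ?N * y0 + 6 * y0' + (if even n then 2 ^ n else 0), 2 * y0)"
      "d 1 (Suc n) = (4 * ?N * y1 + 6 * y1' + (if odd n then 2 ^ n else 0), 2 * y1)"
    using xy by (simp_all add: d_def parity)
  have div: "a / ?N = b" if "a = ?N * b" for a b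
    using that N0 by simp
  have quot: "(fst (d 0 (Suc n)) - fst (c 0 (Suc n))) / ?N = 2 * x0 + 4 * ?N * e0 + 6 * e0'"
      "(snd (d 0 (Suc n)) - snd (c 0 (Suc n))) / ?N = 2 * e0"
      "(fst (d 1 (Suc n)) - fst (c 1 (Suc n))) / ?N = 2 * x1 + 4 * ?N * e1 + 6 * e1'"
      "(snd (d 1 (Suc n)) - snd (c 1 (Suc n))) / ?N = 2 * e1"
    by (rule div, simp only: Suc_c Suc_d y fst_conv snd_conv, simp add: algebra_simps)+
  have g_eq: "g = (\<lambda>p. x0 * H_op N f p + x1 / 2 * H_op N (B_op f) p +
     e0 * J_op N (H_op N f) p + e1 / 2 * J_op N (H_op N (B_op f)) p)"
    using Suc unfolding xy by (simp add: fun_eq_iff g e)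
  have g'_eq: "g' p = x0' * H_op N f p + x1' / 2 * H_op N (B_op f) p +
     e0' * J_op N (H_op N f) p + e1' / 2 * J_op N (H_op N (B_op f)) p"
    using Suc unfolding xy by (simp add: fun_eq_iff g e)
  have J: "J_op N g p = y0 * J_op N (H_op N f) p + y1 / 2 * J_op N (H_op N (B_op f)) p"
    unfolding g_eq J_op_linear J_J y by (simp add: field_simps)
  have *: "fst (transfer_coeffs N f (Suc n)) p = 2 * (?N * g p + J_op N g p) + 6 * g' p +
      2 ^ n * (if even n then H_op N f p else (1 / 2) * H_op N (B_op f) p)"
    "snd (transfer_coeffs N f (Suc n)) p = 2 * g p"
    by (simp_all add: g H_op_B_op_funpow)
  show ?case
    unfolding * J g'_eq quot unfolding Suc_c unfolding g_eq y
    by (cases "even n") (simp_all add: field_simps)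
qed

section \<open>Traces of powers as Lucas polynomials\<close>

text \<open>The sum of the \<open>n\<close>-th powers of the roots of
  \<open>\<lambda>^2 = q \<lambda> + 12\<close>, given by its recursion so that it is a polynomial
  in \<open>q\<close> and needs no square root.\<close>

fun lucas :: "nat \<Rightarrow> 'a::comm_ring_1 \<Rightarrow> 'a" where
  "lucas 0 q = 2"
| "lucas (Suc 0) q = q"
| "lucas (Suc (Suc n)) q = q * lucas (Suc n) q + 12 * lucas n q"

fun fibo :: "nat \<Rightarrow> 'a::comm_ring_1 \<Rightarrow> 'a" where
  "fibo 0 q = 0"
| "fibo (Suc 0) q = 1"
| "fibo (Suc (Suc n)) q = q * fibo (Suc n) q + 12 * fibo n q"

lemma lucas_fibo: "lucas (Suc n) q = fibo (Suc (Suc n)) q + 12 * fibo n q"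
proof (induction n rule: induct_nat_012)
  case (ge2 n)
  have "lucas (Suc (Suc (Suc n))) q = q * lucas (Suc (Suc n)) q + 12 * lucas (Suc n) q"
    by (rule lucas.simps(3))
  then show ?case
    unfolding ge2 by (simp add: algebra_simps)
qed (simp_all add: algebra_simps)

text \<open>The four identities are the entries of \<open>X G = M ^ n - D ^ n\<close>, where \<open>X\<close> has the columns
  \<open>scalar_coeffs q j n\<close>, \<open>M = ((q, 6), (2, 0))\<close>, \<open>D = ((0, 2), (2, 0))\<close> and \<open>G = ((q, 4), (4, q))\<close>; the induction
  works because \<open>G\<close> commutes with \<open>D\<close> and the first row of \<open>M - D\<close> is that of \<open>G\<close>, the second zero.\<close>

lemma scalar_coeffs_fibo:
  fixes q :: "'a::comm_ring_1"
  shows "q * fst (scalar_coeffs q 0 n) + 4 * fst (scalar_coeffs q 1 n) =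
      fibo (Suc n) q - (if even n then 2 ^ n else 0)"
    "q * snd (scalar_coeffs q 0 n) + 4 * snd (scalar_coeffs q 1 n) =
      2 * fibo n q - (if odd n then 2 ^ n else 0)"
    "4 * fst (scalar_coeffs q 0 n) + q * fst (scalar_coeffs q 1 n) =
      6 * fibo n q - (if odd n then 2 ^ n else 0)"
    "4 * snd (scalar_coeffs q 0 n) + q * snd (scalar_coeffs q 1 n) =
      (if n = 0 then 1 else 12 * fibo (n - 1) q) - (if even n then 2 ^ n else 0)"
proof (induction n)
  case 0
  { case 1 show ?case by simp next case 2 show ?case by simp next
    case 3 show ?case by simp next case 4 show ?case by simp }
next
  case (Suc n)
  obtain x x' y y' where xy: "scalar_coeffs q 0 n = (x, x')" "scalar_coeffs q (Suc 0) n = (y, y')"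
    by (metis surj_pair)
  have parity: "(n mod 2 = 0) = even n" "(n mod 2 = Suc 0) = odd n"
    by presburger+
  have IH: "q * x + 4 * y = fibo (Suc n) q - (if even n then 2 ^ n else 0)"
    "q * x' + 4 * y' = 2 * fibo n q - (if odd n then 2 ^ n else 0)"
    "4 * x + q * y = 6 * fibo n q - (if odd n then 2 ^ n else 0)"
    "4 * x' + q * y' = (if n = 0 then 1 else 12 * fibo (n - 1) q) - (if even n then 2 ^ n else 0)"
    using Suc.IH by (simp_all add: xy)
  { case 1
    have "q * (q * x + 6 * x') + 4 * (q * y + 6 * y') = q * (q * x + 4 * y) + 6 * (q * x' + 4 * y')"
      by (simp add: algebra_simps)
    then show ?case
      unfolding IH by (cases "even n") (simp_all add: xy parity algebra_simps)
  next
    case 2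
    have "q * (2 * x) + 4 * (2 * y) = 2 * (q * x + 4 * y)"
      by (simp add: algebra_simps)
    then show ?case
      unfolding IH by (cases "even n") (simp_all add: xy parity algebra_simps)
  next
    case 3
    have "4 * (q * x + 6 * x') + q * (q * y + 6 * y') = q * (4 * x + q * y) + 6 * (4 * x' + q * y')"
      by (simp add: algebra_simps)
    also have "\<dots> = q * (6 * fibo n q) + 6 * (if n = 0 then 1 else 12 * fibo (n - 1) q) -
        (if odd n then q * 2 ^ n else 6 * 2 ^ n)"
      unfolding IH by (simp add: algebra_simps)
    \<comment> \<open>The value \<open>1\<close> at \<open>n = 0\<close> stands for
      \<open>12 * fibo (n - 1) q\<close> with the recursion of \<open>fibo\<close> continued one
      step below \<open>0\<close>.\<close>
    also have "q * (6 * fibo n q) + 6 * (if n = 0 then 1 else 12 * fibo (n - 1) q) = 6 * fibo (Suc n) q"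
      by (cases n) (simp_all add: algebra_simps)
    finally show ?case
      by (cases "even n") (simp_all add: xy parity algebra_simps)
  next
    case 4
    have "4 * (2 * x) + q * (2 * y) = 2 * (4 * x + q * y)"
      by (simp add: algebra_simps)
    then show ?case
      unfolding IH by (cases "even n") (simp_all add: xy parity algebra_simps) }
qed

text \<open>The trace of the matrix identity, that is, the sum of its first and fourth entries:
  \<open>M ^ n\<close> has trace \<open>lucas n q\<close>, and \<open>D ^ n\<close> has trace
  \<open>2 * 2 ^ n\<close> or \<open>0\<close> because the square of \<open>D\<close> is
  \<open>4\<close>.\<close>

lemma scalar_coeffs_lucas:
  fixes q :: "'a::comm_ring_1"
  shows "q * (fst (scalar_coeffs q 0 n) + snd (scalar_coeffs q 1 n)) +
     4 * (fst (scalar_coeffs q 1 n) + snd (scalar_coeffs q 0 n)) =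
     lucas n q - (if even n then 2 * 2 ^ n else 0)"
proof -
  have "lucas n q = fibo (Suc n) q + (if n = 0 then 1 else 12 * fibo (n - 1) q)"
    by (cases n) (simp_all add: lucas_fibo)
  moreover have "q * (fst (scalar_coeffs q 0 n) + snd (scalar_coeffs q 1 n)) +
      4 * (fst (scalar_coeffs q 1 n) + snd (scalar_coeffs q 0 n)) =
      (q * fst (scalar_coeffs q 0 n) + 4 * fst (scalar_coeffs q 1 n)) +
      (4 * snd (scalar_coeffs q 0 n) + q * snd (scalar_coeffs q 1 n))"
    by (simp add: algebra_simps)
  ultimately show ?thesis
    unfolding scalar_coeffs_fibo by simp
qed

text \<open>Two more steps multiply by \<open>4\<close>, starting from the first and second powers.
  \<open>B_op\<close> satisfies only \<open>B^3 = 4 B\<close>, not \<open>B^2 = 4\<close>, so the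
  formula does not extend to \<open>n = 0\<close>, where the trace is \<open>N ^ 4\<close>.\<close>

lemma trace_B_funpow:
  assumes "n > 0"
  shows "(\<Sum>u\<in>colour_tuples N. (B_op ^^ n) (delta u) u) =
    (2 ^ n * (if even n then (of_nat N ^ 4 + of_nat N ^ 2) / 2 else of_nat N ^ 3) :: 'a::field_char_0)"
proof -
  have "(\<Sum>u\<in>colour_tuples N. (B_op ^^ Suc n) (delta u) u) =
    (2 ^ Suc n * (if odd n then (of_nat N ^ 4 + of_nat N ^ 2) / 2 else of_nat N ^ 3) :: 'a)" for n
  proof (induction n rule: induct_nat_012)
    case 0
    then show ?case by (simp add: trace_B)
  next
    case 1
    then show ?case by (simp add: trace_BB)
  next
    case (ge2 n)
    then show ?case
      unfolding B_op_funpow_Suc3 sum_distrib_left[symmetric] by simp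
  qed
  from this[of "n - 1"] assms show ?thesis by simp
qed

section \<open>The generating polynomial of the number of faces\<close>

text \<open>Among the functions of a colour pair, of dimension \<open>x^2\<close>, the image of
  \<open>J_op\<close> is one line, which contributes \<open>4 * x\<close>; the kernel, of dimension
  \<open>x^2 - 1\<close>, contributes \<open>2 * x\<close>. The last summand is the trace of the
  power of \<open>B_op\<close> minus \<open>2 * 2 ^ n * x^2\<close> for even \<open>n\<close>, the
  amount subtracted in \<open>scalar_coeffs_lucas\<close>.\<close>

definition face_polynomial :: "nat \<Rightarrow> 'a \<Rightarrow> 'a::comm_ring_1" where
  "face_polynomial n x = lucas n (4 * x) + (x\<^sup>2 - 1) * lucas n (2 * x) +
     2 ^ (n - 1) * (if even n then x ^ 4 - 3 * x\<^sup>2 else 2 * x ^ 3)"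

lemma sum_power_card_faces_eq:
  assumes "n > 0" "N > 0"
  shows "(\<Sum>\<sigma>\<in>rotation_systems (double_cycle n).
            of_nat N ^ card (faces (double_cycle n) (double_cycle_rev n) \<sigma>)) =
         (face_polynomial n (of_nat N) :: 'a::field_char_0)"
proof -
  let ?V = "colour_tuples N" and ?N = "of_nat N :: 'a"
  let ?c = "scalar_coeffs (2 * ?N)" and ?d = "scalar_coeffs (4 * ?N)"
  let ?bt = "2 ^ n * (if even n then (?N ^ 4 + ?N ^ 2) / 2 else ?N ^ 3)"
  have "(\<Sum>\<sigma>\<in>rotation_systems (double_cycle n).
            of_nat N ^ card (faces (double_cycle n) (double_cycle_rev n) \<sigma>)) =
        (\<Sum>\<alpha>\<in>{..<n} \<rightarrow>\<^sub>E ?V. \<Prod>i<n. (of_nat (vertex_weight (\<alpha> ((i + n - 1) mod n)) (\<alpha> i)) :: 'a))"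
    using arg_cong[OF sum_power_card_faces[OF assms(1), of N], of "of_nat :: nat \<Rightarrow> 'a"] by simp
  also have "\<dots> = (\<Sum>u\<in>?V. (transfer N ^^ n) (delta u) u)"
    by (subst sum_PiE_cycle[OF _ assms(1)]) (simp_all add: transfer_def[abs_def])
  also have "\<dots> = (\<Sum>u\<in>?V. (B_op ^^ n) (delta u) u + K_op (fst (transfer_coeffs N (delta u) n)) u +
      (1 / 2) * B_op (K_op (snd (transfer_coeffs N (delta u) n))) u)"
    by (intro sum.cong refl transfer_funpow)
  also have "\<dots> = (\<Sum>u\<in>?V. (B_op ^^ n) (delta u) u +
     (fst (?c 0 n) * K_op (H_op N (delta u)) u + fst (?c 1 n) / 2 * K_op (H_op N (B_op (delta u))) u +
     (fst (?d 0 n) - fst (?c 0 n)) / ?N * K_op (J_op N (H_op N (delta u))) u +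
     (fst (?d 1 n) - fst (?c 1 n)) / ?N / 2 * K_op (J_op N (H_op N (B_op (delta u)))) u) +
     (1 / 2) * (snd (?c 0 n) * B_op (K_op (H_op N (delta u))) u + snd (?c 1 n) / 2 * B_op (K_op (H_op N (B_op (delta u)))) u +
     (snd (?d 0 n) - snd (?c 0 n)) / ?N * B_op (K_op (J_op N (H_op N (delta u)))) u +
     (snd (?d 1 n) - snd (?c 1 n)) / ?N / 2 * B_op (K_op (J_op N (H_op N (B_op (delta u))))) u))"
  proof (intro sum.cong refl)
    fix u :: "nat \<times> nat \<times> nat \<times> nat"
    have *: "fst (transfer_coeffs N (delta u) n) = (\<lambda>p. fst (?c 0 n) * H_op N (delta u) p + fst (?c 1 n) / 2 * H_op N (B_op (delta u)) p +
     (fst (?d 0 n) - fst (?c 0 n)) / ?N * J_op N (H_op N (delta u)) p +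
     (fst (?d 1 n) - fst (?c 1 n)) / ?N / 2 * J_op N (H_op N (B_op (delta u))) p)"
     "snd (transfer_coeffs N (delta u) n) = (\<lambda>p. snd (?c 0 n) * H_op N (delta u) p + snd (?c 1 n) / 2 * H_op N (B_op (delta u)) p +
     (snd (?d 0 n) - snd (?c 0 n)) / ?N * J_op N (H_op N (delta u)) p +
     (snd (?d 1 n) - snd (?c 1 n)) / ?N / 2 * J_op N (H_op N (B_op (delta u))) p)"
      by (rule ext, rule transfer_coeffs_eq[OF assms(2), THEN conjunct1],
          rule ext, rule transfer_coeffs_eq[OF assms(2), THEN conjunct2])
    have lin2: "K_op (\<lambda>u. f u + g u) = (\<lambda>p. K_op f p + K_op g p)"
        "K_op (\<lambda>u. a * f u) = (\<lambda>p. a * K_op f p)" for f g :: "nat \<times> nat \<Rightarrow> 'a" and a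
      by (rule ext, rule K_op_linear(1), rule ext, rule K_op_linear(2))
    show "(B_op ^^ n) (delta u) u + K_op (fst (transfer_coeffs N (delta u) n)) u +
      (1 / 2) * B_op (K_op (snd (transfer_coeffs N (delta u) n))) u = (B_op ^^ n) (delta u) u +
     (fst (?c 0 n) * K_op (H_op N (delta u)) u + fst (?c 1 n) / 2 * K_op (H_op N (B_op (delta u))) u +
     (fst (?d 0 n) - fst (?c 0 n)) / ?N * K_op (J_op N (H_op N (delta u))) u +
     (fst (?d 1 n) - fst (?c 1 n)) / ?N / 2 * K_op (J_op N (H_op N (B_op (delta u)))) u) +
     (1 / 2) * (snd (?c 0 n) * B_op (K_op (H_op N (delta u))) u + snd (?c 1 n) / 2 * B_op (K_op (H_op N (B_op (delta u)))) u +
     (snd (?d 0 n) - snd (?c 0 n)) / ?N * B_op (K_op (J_op N (H_op N (delta u)))) u +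
     (snd (?d 1 n) - snd (?c 1 n)) / ?N / 2 * B_op (K_op (J_op N (H_op N (B_op (delta u))))) u)"
      unfolding * lin2 B_op_linear by (rule refl)
  qed
  also have "\<dots> = ?bt +
     (fst (?c 0 n) * (2 * ?N ^ 3 + 2 * ?N) + fst (?c 1 n) / 2 * (8 * ?N ^ 2) +
     (fst (?d 0 n) - fst (?c 0 n)) / ?N * (4 * ?N ^ 2) +
     (fst (?d 1 n) - fst (?c 1 n)) / ?N / 2 * (8 * ?N)) +
     (1 / 2) * (snd (?c 0 n) * (8 * ?N ^ 2) + snd (?c 1 n) / 2 * (8 * ?N ^ 3 + 8 * ?N) +
     (snd (?d 0 n) - snd (?c 0 n)) / ?N * (8 * ?N) +
     (snd (?d 1 n) - snd (?c 1 n)) / ?N / 2 * (16 * ?N ^ 2))"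
    unfolding sum.distrib sum_distrib_left[symmetric]
      trace_KH trace_KHB trace_KJH trace_KJHB trace_BKH trace_BKHB trace_BKJH trace_BKJHB
      trace_B_funpow[OF assms(1)] by (rule refl)
  also have "\<dots> = ?bt + (?N\<^sup>2 - 1) * (2 * ?N * (fst (?c 0 n) + snd (?c 1 n)) + 4 * (fst (?c 1 n) + snd (?c 0 n))) +
      (4 * ?N * (fst (?d 0 n) + snd (?d 1 n)) + 4 * (fst (?d 1 n) + snd (?d 0 n)))"
    using assms(2) by (simp add: field_simps power2_eq_square power3_eq_cube)
  also have "\<dots> = face_polynomial n ?N"
    unfolding scalar_coeffs_lucas face_polynomial_def
    using assms(1) by (cases n; cases "even n") (simp_all add: field_simps power2_eq_square)
  finally show ?thesis .
qed

lemma poly_lucas: "poly (lucas n p) x = lucas n (poly p x)"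
  by (induction n rule: induct_nat_012) simp_all

lemma poly_face_polynomial: "poly (face_polynomial n [:0, 1:]) x = face_polynomial n x"
  by (simp add: face_polynomial_def poly_lucas mult.commute)

text \<open>A nonzero polynomial has finitely many roots. The point \<open>N = 0\<close> is left out
  because the trace computation divides by \<open>N\<close>.\<close>

lemma poly_eqI_of_nat:
  fixes p q :: "'a::field_char_0 poly"
  assumes "\<And>N. N > 0 \<Longrightarrow> poly p (of_nat N) = poly q (of_nat N)"
  shows "p = q"
proof (rule ccontr)
  assume "p \<noteq> q"
  then have "finite {x. poly (p - q) x = 0}"
    by (intro poly_roots_finite) simp
  moreover have "(of_nat ` {0<..} :: 'a set) \<subseteq> {x. poly (p - q) x = 0}"
    using assms by auto
  ultimately have "finite (of_nat ` {0<..} :: 'a set)"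
    by (rule rev_finite_subset)
  then have "finite {0::nat<..}"
    by (rule finite_imageD) (simp add: inj_on_def)
  then show False
    using infinite_Ioi by blast
qed

lemma sum_monom_card_faces:
  assumes "n > 0"
  shows "(\<Sum>\<sigma>\<in>rotation_systems (double_cycle n).
            monom 1 (card (faces (double_cycle n) (double_cycle_rev n) \<sigma>))) =
         (face_polynomial n [:0, 1:] :: 'a::field_char_0 poly)"
  by (rule poly_eqI_of_nat)
     (simp add: poly_sum poly_monom poly_face_polynomial sum_power_card_faces_eq[OF assms])

text \<open>Allows arguments that are no numbers of colours: \<open>x = 1\<close> counts rotation
  systems, and the complex unit circle gives the characteristic function.\<close>

lemma sum_power_card_faces_field:
  fixes x :: "'a::field_char_0"
  assumes "n > 0"
  shows "(\<Sum>\<sigma>\<in>rotation_systems (double_cycle n).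
            x ^ card (faces (double_cycle n) (double_cycle_rev n) \<sigma>)) = face_polynomial n x"
  using arg_cong[OF sum_monom_card_faces[OF assms], of "\<lambda>p. poly p x"]
  by (simp add: poly_sum poly_monom poly_face_polynomial)

lemma finite_rotation_systems: "finite (rotation_systems (double_cycle n))"
proof (rule finite_subset)
  show "rotation_systems (double_cycle n) \<subseteq> {\<sigma>. \<sigma> permutes arcs (double_cycle n)}"
    by (auto simp: rotation_systems_def)
qed (simp add: finite_permutations double_cycle_def)

lemma card_edges_double_cycle: "card (edges (double_cycle n) (double_cycle_rev n)) = 2 * n"
proof -
  let ?e = "\<lambda>(i, k). {(i, k, False), (i, k, True)} :: (nat \<times> bool \<times> bool) set"
  have "edges (double_cycle n) (double_cycle_rev n) = ?e ` ({..<n} \<times> UNIV)"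
  proof (intro equalityI subsetI)
    fix X assume "X \<in> edges (double_cycle n) (double_cycle_rev n)"
    then obtain i k d where ikd: "i < n" "X = {(i, k, d), (i, k, \<not> d)}"
      by (auto simp: edges_def double_cycle_def double_cycle_rev_def)
    then have "X = ?e (i, k)" by (cases d) auto
    then show "X \<in> ?e ` ({..<n} \<times> UNIV)" using ikd(1) by blast
  next
    fix X assume "X \<in> ?e ` ({..<n} \<times> UNIV)"
    then obtain i k where ik: "i < n" "X = {(i, k, False), (i, k, True)}" by auto
    then have "X = (\<lambda>a. {a, double_cycle_rev n a}) (i, k, False)"
      by (simp add: double_cycle_rev_def)
    then show "X \<in> edges (double_cycle n) (double_cycle_rev n)"
      using ik(1) unfolding edges_def by (intro image_eqI[where x = "(i, k, False)"]) (simp_all add: double_cycle_def)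
  qed
  moreover have "inj_on ?e ({..<n} \<times> UNIV)"
    by (auto simp: inj_on_def doubleton_eq_iff)
  ultimately show ?thesis
    by (simp add: card_image)
qed

lemma genus_double_cycle:
  "genus (double_cycle n) (double_cycle_rev n) \<sigma> =
     (real n + 2 - real (card (faces (double_cycle n) (double_cycle_rev n) \<sigma>))) / 2"
  unfolding genus_def card_edges_double_cycle by (simp add: double_cycle_def)

lemma num_embeddings_eq_coeff:
  assumes "n > 0" "2 * g \<le> n"
  shows "real (num_embeddings g (double_cycle n) (double_cycle_rev n)) =
    coeff (face_polynomial n [:0, 1:]) (n - 2 * g + 2)"
proof -
  let ?F = "\<lambda>\<sigma>. card (faces (double_cycle n) (double_cycle_rev n) \<sigma>)"
  have "(genus (double_cycle n) (double_cycle_rev n) \<sigma> = real g) \<longleftrightarrow> ?F \<sigma> = n - 2 * g + 2" for \<sigma>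
  proof -
    have "(genus (double_cycle n) (double_cycle_rev n) \<sigma> = real g) \<longleftrightarrow> real (?F \<sigma>) = real (n - 2 * g + 2)"
      using assms(2) by (auto simp: genus_double_cycle of_nat_diff field_simps)
    then show ?thesis by (simp only: of_nat_eq_iff)
  qed
  then have "real (num_embeddings g (double_cycle n) (double_cycle_rev n)) =
      real (card {\<sigma> \<in> rotation_systems (double_cycle n). ?F \<sigma> = n - 2 * g + 2})"
    by (simp add: num_embeddings_def)
  also have "\<dots> = (\<Sum>\<sigma>\<in>rotation_systems (double_cycle n). coeff (monom 1 (?F \<sigma>)) (n - 2 * g + 2))"
    using finite_rotation_systems[of n] by (simp add: sum.If_cases Int_def)
  also have "\<dots> = coeff (face_polynomial n [:0, 1:]) (n - 2 * g + 2)"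
    by (simp only: sum_monom_card_faces[OF assms(1), symmetric] coeff_sum)
  finally show ?thesis .
qed

section \<open>Explicit coefficients and the number of embeddings\<close>

lemma coeff_lucas_eq_0: "m > n \<Longrightarrow> coeff (lucas n [:0, c:]) m = (0::'a::comm_ring_1)"
proof (induction n arbitrary: m rule: induct_nat_012)
  case 0
  then show ?case by (cases m) (simp_all add: numeral_poly)
next
  case 1
  then show ?case by (cases m; cases "m - 1") simp_all
next
  case (ge2 n)
  then obtain m' where "m = Suc m'" by (cases m) auto
  then show ?case using ge2 by (simp add: numeral_poly)
qed

text \<open>The coefficient of \<open>q ^ k * 12 ^ j\<close> in \<open>lucas (k + 2 * j) q\<close>; the quotient would be \<open>0 / 0\<close> for
  \<open>k = j = 0\<close>.\<close>

definition lucas_number :: "nat \<Rightarrow> nat \<Rightarrow> real" where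
  "lucas_number k j = (if k + j = 0 then 2 else real (k + 2 * j) / real (k + j) * real ((k + j) choose j))"

lemma lucas_number_0_left: "lucas_number 0 j = 2"
  by (simp add: lucas_number_def divide_simps)

text \<open>Absorption expresses both smaller binomials through the single binomial
  \<open>C\<close>, leaving an identity of rational functions.\<close>

lemma lucas_number_rec: "lucas_number (Suc k) (Suc j) = lucas_number k (Suc j) + lucas_number (Suc k) j"
proof -
  define C where "C = real ((Suc k + Suc j) choose Suc j)"
  have "Suc k * ((Suc k + Suc j) choose Suc j) = (Suc k + Suc j) * ((k + Suc j) choose Suc j)"
    using binomial_absorb_comp[of "Suc k + Suc j" "Suc j"] by simp
  then have "real (Suc k) * C = real (Suc k + Suc j) * real ((k + Suc j) choose Suc j)"
    unfolding C_def by (metis of_nat_mult)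
  then have 1: "real ((k + Suc j) choose Suc j) = (real k + 1) * C / (real k + real j + 2)"
    by (simp add: field_simps del: binomial_Suc_Suc)
  have "Suc j * ((Suc k + Suc j) choose Suc j) = (Suc k + Suc j) * ((Suc k + j) choose j)"
    using Suc_times_binomial_eq[of "Suc k + j" j] by (simp add: mult.commute del: binomial_Suc_Suc)
  then have "real (Suc j) * C = real (Suc k + Suc j) * real ((Suc k + j) choose j)"
    unfolding C_def by (metis of_nat_mult)
  then have 2: "real ((Suc k + j) choose j) = (real j + 1) * C / (real k + real j + 2)"
    by (simp add: field_simps del: binomial_Suc_Suc)
  have pos: "real k + real j + 2 \<noteq> 0" "real k + real j + 1 \<noteq> 0" by linarith+
  have "lucas_number k (Suc j) + lucas_number (Suc k) j =
      (real k + 2 * real j + 2) / (real k + real j + 1) * ((real k + 1) * C / (real k + real j + 2)) +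
      (real k + 2 * real j + 1) / (real k + real j + 1) * ((real j + 1) * C / (real k + real j + 2))"
    unfolding lucas_number_def 1 2 by (simp add: algebra_simps)
  also have "\<dots> = (real k + 2 * real j + 3) / (real k + real j + 2) * C"
    using pos by (simp add: divide_simps) algebra
  also have "\<dots> = lucas_number (Suc k) (Suc j)"
    unfolding lucas_number_def C_def by (simp add: algebra_simps)
  finally show ?thesis ..
qed

text \<open>Each step of the recursion either raises \<open>k\<close> by one or \<open>j\<close> by
  one, so the coefficients follow the Pascal-like rule \<open>lucas_number_rec\<close>; the
  boundaries are the leading coefficient (\<open>j = 0\<close>) and the constant one
  (\<open>k = 0\<close>).\<close>

lemma coeff_lucas:
  "coeff (lucas (k + 2 * j) [:0, c:]) k = lucas_number k j * 12 ^ j * c ^ k"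
proof (induction "k + 2 * j" arbitrary: k j rule: less_induct)
  case less
  show ?case
  proof (cases j)
    case 0
    consider "k = 0" | "k = 1" | k' where "k = Suc (Suc k')"
      by (metis One_nat_def not0_implies_Suc)
    then show ?thesis
    proof cases
      case 1
      then show ?thesis using \<open>j = 0\<close> by (simp add: lucas_number_def numeral_poly)
    next
      case 2
      then show ?thesis using \<open>j = 0\<close> by (simp add: lucas_number_def)
    next
      case 3
      then show ?thesis
        using \<open>j = 0\<close> less[of "Suc k'" 0]
        by (simp add: lucas_number_def numeral_poly coeff_lucas_eq_0)
    qed
  next
    case (Suc j')
    have sum: "k + 2 * j = Suc (Suc (k + 2 * j'))" using Suc by simp
    show ?thesis
    proof (cases k)
      case 0
      then show ?thesis
        using less[of 0 j'] Suc unfolding sum by (simp add: numeral_poly lucas_number_0_left)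
    next
      case (Suc k')
      have "k' + 2 * Suc j' = Suc (k + 2 * j')" using Suc by simp
      then have "coeff (lucas (Suc (k + 2 * j')) [:0, c:]) k' = lucas_number k' (Suc j') * 12 ^ Suc j' * c ^ k'"
        using less[of k' "Suc j'"] sum Suc by simp
      moreover have "coeff (lucas (k + 2 * j') [:0, c:]) k = lucas_number k j' * 12 ^ j' * c ^ k"
        using less[of k j'] sum by simp
      moreover have "coeff ([:0, c:] * p + 12 * q) k = c * coeff p k' + 12 * coeff q k" for p q
        using Suc by (simp add: numeral_poly)
      ultimately have "coeff (lucas (k + 2 * j) [:0, c:]) k =
          c * (lucas_number k' (Suc j') * 12 ^ Suc j' * c ^ k') + 12 * (lucas_number k j' * 12 ^ j' * c ^ k)"
        unfolding sum lucas.simps(3) by (simp only:)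
      then show ?thesis
        using Suc \<open>j = Suc j'\<close> by (simp add: lucas_number_rec algebra_simps)
    qed
  qed
qed

text \<open>Here \<open>m = n - 2 * g\<close>, and genus \<open>g\<close> means \<open>m + 2\<close>
  faces. The factor \<open>x^2\<close> in front of \<open>lucas n (2 * x)\<close> shifts the degree,
  which brings in the coefficient at \<open>m\<close>; \<open>m > 2\<close> puts
  \<open>m + 2\<close> above the degree of the power-of-two summand.\<close>

lemma num_embeddings_double_cycle:
  assumes "g > 0" "m > 2"
  shows "real (num_embeddings g (double_cycle (m + 2 * g)) (double_cycle_rev (m + 2 * g))) =
    lucas_number (m + 2) (g - 1) * 12 ^ (g - 1) * (4 ^ (m + 2) - 2 ^ (m + 2)) +
    lucas_number m g * 12 ^ g * 2 ^ m"
proof -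
  let ?n = "m + 2 * g"
  have n: "?n = (m + 2) + 2 * (g - 1)" using assms(1) by simp
  have 1: "coeff (lucas ?n [:0, c:]) (m + 2) = lucas_number (m + 2) (g - 1) * 12 ^ (g - 1) * c ^ (m + 2)" for c :: real
    unfolding n by (rule coeff_lucas)
  have X: "4 * [:0, 1:] = [:0, 4::real:]" "2 * [:0, 1:] = [:0, 2::real:]"
    by (simp_all add: numeral_poly)
  have P: "(2 :: real poly) ^ k = [:2 ^ k:]" for k
    by (simp add: numeral_poly poly_const_pow)
  have poly_eq: "face_polynomial ?n [:0, 1:] = lucas ?n [:0, 4::real:] + monom 1 2 * lucas ?n [:0, 2:] -
      lucas ?n [:0, 2:] + smult (2 ^ (?n - 1)) (if even ?n then monom 1 4 - smult 3 (monom 1 2) else smult 2 (monom 1 3))"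
    unfolding face_polynomial_def X P
    by (simp add: monom_altdef algebra_simps numeral_poly)
  have "coeff (face_polynomial ?n [:0, 1:]) (m + 2) =
     coeff (lucas ?n [:0, 4::real:]) (m + 2) + coeff (lucas ?n [:0, 2:]) m - coeff (lucas ?n [:0, 2:]) (m + 2)"
    unfolding poly_eq using assms(2) by (simp add: coeff_monom_mult)
  then show ?thesis
    using num_embeddings_eq_coeff[of ?n g] assms unfolding 1 coeff_lucas by (simp add: algebra_simps)
qed

section \<open>Stirling's formula and the uniform estimate\<close>

definition stirling_ratio :: "nat \<Rightarrow> real" where
  "stirling_ratio n = fact n / (sqrt (2 * pi * real n) * (real n / exp 1) ^ n)"

lemma wallis_product_eq:
  "(\<Prod>k=1..n. (4 * real k ^ 2) / (4 * real k ^ 2 - 1)) =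
     16 ^ n * fact n ^ 4 / (fact (2 * n) ^ 2 * (2 * real n + 1))"
proof (induction n)
  case (Suc n)
  define A :: real where "A = fact n"
  define B :: real where "B = fact (2 * n)"
  have pos: "A > 0" "B > 0" by (simp_all add: A_def B_def)
  have 1: "fact (Suc n) = (real n + 1) * A"
    by (simp add: A_def algebra_simps)
  have 2: "fact (2 * Suc n) = (2 * real n + 2) * ((2 * real n + 1) * B)"
    by (simp add: B_def algebra_simps)
  have 3: "4 * real (Suc n) ^ 2 - 1 = (2 * real n + 1) * (2 * real n + 3)"
    by (simp add: power2_eq_square algebra_simps)
  have "(\<Prod>k=1..Suc n. (4 * real k ^ 2) / (4 * real k ^ 2 - 1)) =
      16 ^ n * A ^ 4 / (B ^ 2 * (2 * real n + 1)) *
        (4 * (real n + 1) ^ 2 / ((2 * real n + 1) * (2 * real n + 3)))"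
    unfolding prod.cl_ivl_Suc Suc.IH 3 by (simp add: A_def B_def add.commute)
  also have "\<dots> = 16 ^ Suc n * ((real n + 1) * A) ^ 4 /
      (((2 * real n + 2) * ((2 * real n + 1) * B)) ^ 2 * (2 * real (Suc n) + 1))"
  proof -
    have "2 * real n + 2 = 2 * (real n + 1)" "2 * real (Suc n) + 1 = 2 * real n + 3" by simp_all
    moreover have "real n + 1 \<noteq> 0" "2 * real n + 1 \<noteq> 0" "2 * real n + 3 \<noteq> 0" by linarith+
    ultimately show ?thesis
      using pos by (simp add: divide_simps power_mult_distrib) (simp add: power4_eq_xxxx power2_eq_square algebra_simps)
  qed
  finally show ?case unfolding 1 2 .
qed simp

text \<open>The logarithm of \<open>n! / (\<surd>n (n/e)^n)\<close> is decreasing, and stays so bounded from below because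
  its increments are controlled by the trapezoidal rule for \<open>1/x\<close>; Wallis' product gives the limit.\<close>

lemma stirling_ratio_tendsto_1: "stirling_ratio \<longlonglongrightarrow> 1"
proof -
  \<comment> \<open>\<open>b n\<close> belongs to the argument \<open>Suc n\<close>, which keeps the
    logarithm away from \<open>0\<close>.\<close>
  define b where "b = (\<lambda>n. ln (fact (Suc n)) - (real (Suc n) + 1 / 2) * ln (real (Suc n)) + real (Suc n))"
  have step: "b n - b (Suc n) = (real (Suc n) + 1 / 2) * (ln (real (Suc n) + 1) - ln (real (Suc n))) - 1" for n
  proof -
    have "ln (fact (Suc (Suc n)) :: real) = ln (real (Suc n) + 1) + ln (fact (Suc n))"
      unfolding fact_Suc[of "Suc n"] by (subst ln_mult) (simp_all add: add.commute)
    then show ?thesis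
      by (simp add: b_def algebra_simps)
  qed
  have dec: "b (Suc n) \<le> b n" for n
  proof -
    have "2 / (2 * real (Suc n) + 1) \<le> ln (real (Suc n) + 1) - ln (real (Suc n))"
      using ln_inverse_approx_ge[of "real (Suc n)" "real (Suc n) + 1"] by simp
    then have "(real (Suc n) + 1 / 2) * (2 / (2 * real (Suc n) + 1)) \<le>
        (real (Suc n) + 1 / 2) * (ln (real (Suc n) + 1) - ln (real (Suc n)))"
      by (intro mult_left_mono) auto
    moreover have "(real (Suc n) + 1 / 2) * (2 / (2 * real (Suc n) + 1)) = 1"
      by (simp add: field_simps)
    ultimately show ?thesis using step[of n] by linarith
  qed
  have inc: "b n - 1 / (4 * real (Suc n)) \<le> b (Suc n) - 1 / (4 * real (Suc (Suc n)))" for n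
  proof -
    define x where "x = real (Suc n)"
    have x: "x > 0" by (simp add: x_def)
    have "ln (x + 1) - ln x \<le> (inverse x + inverse (x + 1)) / 2"
      using ln_inverse_approx_le[of x 1] x by simp
    then have "(x + 1 / 2) * (ln (x + 1) - ln x) \<le> (x + 1 / 2) * ((inverse x + inverse (x + 1)) / 2)"
      using x by (intro mult_left_mono) auto
    also have "\<dots> = 1 + 1 / (4 * x) - 1 / (4 * (x + 1))"
      using x by (simp add: divide_simps) (simp add: algebra_simps)
    finally show ?thesis
      using step[of n] by (simp add: x_def add.commute)
  qed
  have lower: "b 0 - 1 / 4 \<le> b n" for n
  proof -
    have "b 0 - 1 / 4 \<le> b n - 1 / (4 * real (Suc n))"
    proof (induction n)
      case (Suc n)
      then show ?case using inc[of n] by linarith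
    qed simp
    moreover have "1 / (4 * real (Suc n)) \<ge> 0" by simp
    ultimately show ?thesis by linarith
  qed
  have "decseq b"
    using dec by (rule decseq_SucI)
  then obtain L where L: "b \<longlonglongrightarrow> L"
    using decseq_convergent[of b "b 0 - 1 / 4"] lower by blast
  define s where "s = (\<lambda>n. fact n / (sqrt (real n) * (real n / exp 1) ^ n) :: real)"
  have s_Suc: "s (Suc n) = exp (b n)" for n
  proof -
    have "exp (b n) = fact (Suc n) / exp ((real (Suc n) + 1 / 2) * ln (real (Suc n))) * exp (real (Suc n))"
      by (simp add: b_def exp_add exp_diff)
    also have "exp ((real (Suc n) + 1 / 2) * ln (real (Suc n))) = real (Suc n) powr (real (Suc n) + 1 / 2)"
      by (simp add: powr_def)
    also have "\<dots> = real (Suc n) ^ Suc n * sqrt (real (Suc n))"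
      by (simp only: powr_add powr_half_sqrt powr_realpow of_nat_0_less_iff zero_less_Suc of_nat_0_le_iff)
    also have "exp (real (Suc n)) = exp 1 ^ Suc n"
      by (metis exp_of_nat_mult mult.right_neutral)
    finally show ?thesis
      by (simp add: s_def power_divide divide_simps) (simp add: mult_ac)
  qed
  have s_lim: "s \<longlonglongrightarrow> exp L"
    by (rule LIMSEQ_imp_Suc) (unfold s_Suc, intro tendsto_intros L)
  have s_lim2: "(\<lambda>n. s (2 * n)) \<longlonglongrightarrow> exp L"
    by (rule filterlim_compose[OF s_lim mult_nat_left_at_top]) simp
  have quarter: "(\<lambda>n. real n / (2 * (2 * real n + 1))) \<longlonglongrightarrow> 1 / 4"
    by real_asymp
  \<comment> \<open>In this quotient the factors \<open>(n / e) ^ n\<close> cancel up to powers of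
    two and Wallis' partial product remains, so \<open>exp L ^ 2 / 4\<close> must be
    \<open>pi / 2\<close>.\<close>
  have "(\<lambda>n. s n ^ 4 / s (2 * n) ^ 2 * (real n / (2 * (2 * real n + 1)))) \<longlonglongrightarrow> exp L ^ 4 / exp L ^ 2 * (1 / 4)"
    by (rule tendsto_mult[OF tendsto_divide[OF tendsto_power[OF s_lim] tendsto_power[OF s_lim2]] quarter]) simp
  moreover have "\<forall>\<^sub>F n in sequentially. s n ^ 4 / s (2 * n) ^ 2 * (real n / (2 * (2 * real n + 1))) =
      (\<Prod>k=1..n. (4 * real k ^ 2) / (4 * real k ^ 2 - 1))"
  proof (rule eventually_sequentiallyI)
    fix n :: nat assume "1 \<le> n"
    define X where "X = (real n / exp 1) ^ n"
    have X: "X > 0" using \<open>1 \<le> n\<close> by (simp add: X_def)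
    have X2: "(real (2 * n) / exp 1) ^ (2 * n) = 4 ^ n * X ^ 2"
    proof -
      have "real (2 * n) / exp 1 = 2 * (real n / exp 1)" by simp
      then have "(real (2 * n) / exp 1) ^ (2 * n) = ((2 * (real n / exp 1)) ^ n)\<^sup>2"
        by (simp only: mult.commute[of 2 n] power_mult)
      also have "\<dots> = ((2 ^ n)\<^sup>2) * X\<^sup>2"
        by (simp only: X_def power_mult_distrib)
      also have "((2::real) ^ n)\<^sup>2 = 4 ^ n"
        by (simp add: power2_eq_square flip: power_mult_distrib)
      finally show ?thesis .
    qed
    have 4: "s n ^ 4 = fact n ^ 4 / (real n ^ 2 * X ^ 4)"
    proof -
      have "sqrt (real n) ^ 4 = ((sqrt (real n))\<^sup>2)\<^sup>2"
        by (simp only: power4_eq_xxxx power2_eq_square mult.assoc)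
      then have root: "sqrt (real n) ^ 4 = (real n)\<^sup>2"
        by simp
      have "s n = fact n / (sqrt (real n) * X)"
        by (simp only: s_def X_def)
      then show ?thesis
        by (simp only: power_divide power_mult_distrib root)
    qed
    have 5: "s (2 * n) ^ 2 = fact (2 * n) ^ 2 / (2 * real n * (16 ^ n * X ^ 4))"
    proof -
      have "(X\<^sup>2)\<^sup>2 = X ^ 4"
        by (simp only: power4_eq_xxxx power2_eq_square mult.assoc)
      moreover have "((4::real) ^ n)\<^sup>2 = 16 ^ n"
        by (simp add: power2_eq_square flip: power_mult_distrib)
      ultimately have "(4 ^ n * X\<^sup>2)\<^sup>2 = 16 ^ n * X ^ 4"
        by (simp only: power_mult_distrib)
      moreover have "(sqrt (real (2 * n)))\<^sup>2 = 2 * real n"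
        by simp
      moreover have "s (2 * n) = fact (2 * n) / (sqrt (real (2 * n)) * (4 ^ n * X\<^sup>2))"
        by (simp only: s_def X2)
      ultimately show ?thesis
        by (simp only: power_divide power_mult_distrib[of "sqrt (real (2 * n))"])
    qed
    have "f / (x\<^sup>2 * w) / (g / (2 * x * (a * w))) * (x / (2 * (2 * x + 1))) = a * f / (g * (2 * x + 1))"
      if "x > 0" "w > 0" "g > 0" for f g a w x :: real
      using that by (simp add: divide_simps power2_eq_square)
    then show "s n ^ 4 / s (2 * n) ^ 2 * (real n / (2 * (2 * real n + 1))) =
      (\<Prod>k=1..n. (4 * real k ^ 2) / (4 * real k ^ 2 - 1))"
      unfolding wallis_product_eq 4 5 using X \<open>1 \<le> n\<close> by simp
  qed
  ultimately have "(\<lambda>n. \<Prod>k=1..n. (4 * real k ^ 2) / (4 * real k ^ 2 - 1)) \<longlonglongrightarrow> exp L ^ 4 / exp L ^ 2 * (1 / 4)"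
    by (rule Lim_transform_eventually)
  then have "exp L ^ 4 / exp L ^ 2 * (1 / 4) = pi / 2"
    using wallis LIMSEQ_unique by blast
  then have "exp L ^ 2 = 2 * pi"
    by (simp add: power4_eq_xxxx power2_eq_square)
  then have eL: "exp L = sqrt (2 * pi)"
    by (metis exp_ge_zero real_sqrt_unique)
  have "(\<lambda>n. s n / sqrt (2 * pi)) \<longlonglongrightarrow> exp L / sqrt (2 * pi)"
    by (intro tendsto_intros s_lim) simp
  moreover have "(\<lambda>n. s n / sqrt (2 * pi)) = stirling_ratio"
    by (simp add: fun_eq_iff s_def stirling_ratio_def real_sqrt_mult)
  ultimately show ?thesis by (simp add: eL)
qed

text \<open>An exact identity: all error sits in the \<open>stirling_ratio\<close> factors, so the
  uniform estimate becomes a limit of a product.\<close>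

lemma binomial_stirling:
  fixes m g :: nat
  assumes "m > 0" "g > 0"
  shows "real ((m + g) choose g) = stirling_ratio (m + g) / (stirling_ratio m * stirling_ratio g) *
    (sqrt ((real m + real g) / (2 * pi * real m * real g)) *
     ((real m + real g) ^ (m + g) / (real m ^ m * real g ^ g)))"
proof -
  have fact: "fact n = stirling_ratio n * (sqrt (2 * pi * real n) * (real n / exp 1) ^ n)" if "n > 0" for n
    using that by (simp add: stirling_ratio_def)
  have sr: "stirling_ratio n > 0" if "n > 0" for n
    using that by (simp add: stirling_ratio_def)
  have sq: "sqrt (2 * pi * (real m + real g)) / (sqrt (2 * pi * real m) * sqrt (2 * pi * real g)) =
      sqrt ((real m + real g) / (2 * pi * real m * real g))"
    using assms by (simp add: real_sqrt_divide[symmetric] real_sqrt_mult[symmetric] field_simps)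
  have pw: "((real m + real g) / exp 1) ^ (m + g) / ((real m / exp 1) ^ m * (real g / exp 1) ^ g) =
      (real m + real g) ^ (m + g) / (real m ^ m * real g ^ g)"
    by (simp add: power_divide power_add)
  have "real ((m + g) choose g) = fact (m + g) / (fact m * fact g)"
    by (simp add: binomial_fact mult.commute)
  also have "\<dots> = stirling_ratio (m + g) / (stirling_ratio m * stirling_ratio g) *
     (sqrt (2 * pi * (real m + real g)) / (sqrt (2 * pi * real m) * sqrt (2 * pi * real g)) *
     (((real m + real g) / exp 1) ^ (m + g) / ((real m / exp 1) ^ m * (real g / exp 1) ^ g)))"
    using assms by (simp add: fact)
  finally show ?thesis unfolding sq pw .
qed


section \<open>Comparison with the claimed asymptotic value\<close>

text \<open>Both coefficients become rational multiples of the same binomial, so that they share one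
  Stirling factor.\<close>

lemma lucas_number_binomial:
  assumes "m > 0" "g > 0"
  shows "lucas_number m g = (real m + 2 * real g) / (real m + real g) * real ((m + g) choose g)"
    "lucas_number (m + 2) (g - 1) =
       (real m + 2 * real g) * real g / ((real m + 1) * (real m + 2)) * real ((m + g) choose g)"
proof -
  obtain h where g: "g = Suc h" using assms(2) by (cases g) auto
  show "lucas_number m g = (real m + 2 * real g) / (real m + real g) * real ((m + g) choose g)"
    using assms by (simp add: lucas_number_def)
  have "real ((m + 2 + h) choose h) = fact (m + 2 + h) / (fact h * fact (m + 2))"
    by (simp add: binomial_fact)
  also have "fact (m + 2 + h) = (real m + real g + 1) * fact (m + g)"
    by (simp add: g algebra_simps)
  also have "fact (m + 2) = (real m + 2) * ((real m + 1) * fact m)"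
    by (simp add: algebra_simps)
  also have "(real m + real g + 1) * fact (m + g) / (fact h * ((real m + 2) * ((real m + 1) * fact m))) =
      (real m + real g + 1) * real g / ((real m + 1) * (real m + 2)) * (fact (m + g) / (fact g * fact m))"
  proof -
    have "fact g = real g * (fact h :: real)" by (simp add: g)
    moreover have "real m + 1 \<noteq> 0" "real m + 2 \<noteq> 0" "real g \<noteq> 0" using assms by linarith+
    ultimately show ?thesis by (simp add: divide_simps)
  qed
  also have "fact (m + g) / (fact g * fact m) = real ((m + g) choose g)"
    by (simp add: binomial_fact)
  finally have *: "real ((m + 2 + h) choose h) =
      (real m + real g + 1) * real g / ((real m + 1) * (real m + 2)) * real ((m + g) choose g)" .
  have "lucas_number (m + 2) (g - 1) =
      (real m + 2 * real g) / (real m + real g + 1) * real ((m + 2 + h) choose h)"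
    by (simp add: lucas_number_def g add_ac)
  also have "\<dots> = (real m + 2 * real g) * real g / ((real m + 1) * (real m + 2)) * real ((m + g) choose g)"
  proof -
    have "real m + real g + 1 \<noteq> 0" by linarith
    then show ?thesis unfolding * by (simp add: divide_simps)
  qed
  finally show "lucas_number (m + 2) (g - 1) =
       (real m + 2 * real g) * real g / ((real m + 1) * (real m + 2)) * real ((m + g) choose g)" .
qed

definition asymptotic_value :: "nat \<Rightarrow> nat \<Rightarrow> real" where
  "asymptotic_value g n = (let t = 1 / (1 - 2 * real g / real n) in
     t / 3 * sqrt (2 * t * (t\<^sup>2 - 1) / (pi * real n)) * (3 / (t\<^sup>2 - 1)) ^ g * (2 * (1 + t)) ^ n)"

text \<open>With \<open>m = n - 2 * g\<close> one has \<open>t = n / m\<close>, so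
  \<open>t^2 - 1\<close> and \<open>2 * (1 + t)\<close> are \<open>4 g (m + g) / m^2\<close> and
  \<open>4 (m + g) / m\<close>; the powers of \<open>t\<close> turn into the entropy term of the
  binomial.\<close>

lemma asymptotic_value_eq:
  fixes m g :: nat
  assumes "m > 0" "g > 0"
  shows "asymptotic_value g (m + 2 * g) =
    12 ^ (g - 1) * 4 ^ (m + 2) * ((real m + 2 * real g) * real g / real m ^ 2) *
    (sqrt ((real m + real g) / (2 * pi * real m * real g)) *
     ((real m + real g) ^ (m + g) / (real m ^ m * real g ^ g)))"
proof -
  define x y where "x = real m" and "y = real g"
  have xy: "x > 0" "y > 0" using assms by (simp_all add: x_def y_def)
  define t where "t = 1 / (1 - 2 * y / (x + 2 * y))"
  have t: "t = (x + 2 * y) / x"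
    using xy by (simp add: t_def field_simps)
  have t2: "t\<^sup>2 - 1 = 4 * y * (x + y) / x\<^sup>2"
    using xy by (simp add: t field_simps power2_eq_square)
  have t1: "2 * (1 + t) = 4 * (x + y) / x"
    using xy by (simp add: t field_simps)
  \<comment> \<open>Writing \<open>n = m + 2 * g\<close> pairs each of the \<open>g\<close> factors
    with a square of \<open>2 * (1 + t)\<close>; the base becomes
    \<open>12 * (x + y) / y\<close>.\<close>
  have pow: "(3 / (t\<^sup>2 - 1)) ^ g * (2 * (1 + t)) ^ (m + 2 * g) =
      12 ^ g * 4 ^ m * ((x + y) ^ (m + g) / (x ^ m * y ^ g))"
  proof -
    have "(3 / (t\<^sup>2 - 1)) ^ g * (2 * (1 + t)) ^ (m + 2 * g) =
        (3 / (t\<^sup>2 - 1) * (2 * (1 + t))\<^sup>2) ^ g * (2 * (1 + t)) ^ m"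
      by (simp only: power_add power_mult power_mult_distrib) (simp only: mult_ac)
    also have "3 / (t\<^sup>2 - 1) * (2 * (1 + t))\<^sup>2 = 12 * ((x + y) / y)"
      unfolding t2 t1 using xy by (simp add: divide_simps) (simp add: power2_eq_square algebra_simps)
    finally show ?thesis
      unfolding t1 power_mult_distrib power_divide power_add by (simp add: mult_ac)
  qed
  have pre: "t / 3 * sqrt (2 * t * (t\<^sup>2 - 1) / (pi * (x + 2 * y))) =
      4 / 3 * ((x + 2 * y) * y / x ^ 2) * sqrt ((x + y) / (2 * pi * x * y))"
  proof -
    have "2 * t * (t\<^sup>2 - 1) / (pi * (x + 2 * y)) = (4 * y / x)\<^sup>2 * ((x + y) / (2 * pi * x * y))"
      unfolding t2 unfolding t using xy by (simp add: divide_simps) (simp add: power2_eq_square)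
    then have "sqrt (2 * t * (t\<^sup>2 - 1) / (pi * (x + 2 * y))) =
        sqrt ((4 * y / x)\<^sup>2) * sqrt ((x + y) / (2 * pi * x * y))"
      by (simp only: real_sqrt_mult)
    also have "sqrt ((4 * y / x)\<^sup>2) = 4 * y / x"
      using xy by simp
    finally have "sqrt (2 * t * (t\<^sup>2 - 1) / (pi * (x + 2 * y))) = 4 * y / x * sqrt ((x + y) / (2 * pi * x * y))" .
    then show ?thesis
      using xy by (simp add: t power2_eq_square)
  qed
  have g: "(12::real) ^ g = 12 * 12 ^ (g - 1)"
    using assms(2) by (cases g) simp_all
  have "asymptotic_value g (m + 2 * g) = (t / 3 * sqrt (2 * t * (t\<^sup>2 - 1) / (pi * (x + 2 * y)))) *
      ((3 / (t\<^sup>2 - 1)) ^ g * (2 * (1 + t)) ^ (m + 2 * g))"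
    by (simp add: asymptotic_value_def Let_def t_def x_def y_def)
  also have "\<dots> = 12 ^ (g - 1) * 4 ^ (m + 2) * ((x + 2 * y) * y / x ^ 2) *
      (sqrt ((x + y) / (2 * pi * x * y)) * ((x + y) ^ (m + g) / (x ^ m * y ^ g)))"
    unfolding pow pre g by (simp add: power_add)
  finally show ?thesis unfolding x_def y_def .
qed

text \<open>The factors are the Stirling error, the ratio of \<open>m^2\<close> to the denominator
  in \<open>lucas_number (m + 2) (g - 1)\<close>, and the effect of the \<open>2 * x\<close> family.
  The constant \<open>3 / 4\<close> is \<open>12 / 16\<close>: \<open>12\<close> from
  \<open>12 ^ g\<close> against \<open>12 ^ (g - 1)\<close>, and \<open>16\<close> from
  \<open>4 ^ (m + 2)\<close> against \<open>4 ^ m\<close>.\<close>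

definition error_factor :: "nat \<Rightarrow> nat \<Rightarrow> real" where
  "error_factor m g = stirling_ratio (m + g) / (stirling_ratio m * stirling_ratio g) *
     (real m ^ 2 / ((real m + 1) * (real m + 2))) *
     (1 - (1 / 2) ^ (m + 2) + 3 / 4 * (((real m + 1) * (real m + 2) * (1 / 2) ^ m) * (1 / real g) * (1 / real (m + g))))"

lemma num_embeddings_over_asymptotic_value:
  fixes m g :: nat
  assumes "m > 2" "g > 0"
  shows "real (num_embeddings g (double_cycle (m + 2 * g)) (double_cycle_rev (m + 2 * g))) =
    asymptotic_value g (m + 2 * g) * error_factor m g"
    "asymptotic_value g (m + 2 * g) > 0"
proof -
  define x y where "x = real m" and "y = real g"
  have m: "m > 0" using assms(1) by simp
  have xy: "x > 0" "y > 0" using assms by (simp_all add: x_def y_def)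
  have g: "(12::real) ^ g = 12 * 12 ^ (g - 1)"
    using assms(2) by (cases g) simp_all
  have p: "(1 / 2 :: real) ^ (m + 2) * 4 ^ (m + 2) = 2 ^ (m + 2)" "(1 / 2 :: real) ^ m * 4 ^ (m + 2) = 16 * 2 ^ m"
    by (simp_all add: power_add flip: power_mult_distrib)
  define S where "S = sqrt ((x + y) / (2 * pi * x * y)) * ((x + y) ^ (m + g) / (x ^ m * y ^ g))"
  define R where "R = stirling_ratio (m + g) / (stirling_ratio m * stirling_ratio g)"
  define h where "h = (1 / 2 :: real) ^ m"
  have h: "2 ^ (m + 2) = h / 4 * 4 ^ (m + 2)" "2 ^ m = h / 16 * 4 ^ (m + 2)" "(1 / 2) ^ (m + 2) = h / 4"
    using p by (simp_all add: h_def power_add)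
  have C: "real ((m + g) choose g) = R * S"
    unfolding binomial_stirling[OF m assms(2)] R_def S_def x_def y_def by (rule refl)
  have "real (num_embeddings g (double_cycle (m + 2 * g)) (double_cycle_rev (m + 2 * g))) =
      (x + 2 * y) * y / ((x + 1) * (x + 2)) * (R * S) * 12 ^ (g - 1) * (4 ^ (m + 2) - h / 4 * 4 ^ (m + 2)) +
      (x + 2 * y) / (x + y) * (R * S) * (12 * 12 ^ (g - 1)) * (h / 16 * 4 ^ (m + 2))"
    unfolding num_embeddings_double_cycle[OF assms(2,1)] lucas_number_binomial[OF m assms(2)] C g h
    by (simp add: x_def y_def)
  also have "\<dots> = 12 ^ (g - 1) * 4 ^ (m + 2) * ((x + 2 * y) * y / x ^ 2) * S *
      (R * (x ^ 2 / ((x + 1) * (x + 2))) *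
      (1 - h / 4 + 3 / 4 * (((x + 1) * (x + 2) * h) * (1 / y) * (1 / (x + y)))))"
  proof -
    define \<alpha> where "\<alpha> = (x + 2 * y) * y / ((x + 1) * (x + 2))"
    define \<beta> where "\<beta> = (x + 2 * y) / (x + y)"
    have nz: "x + 1 \<noteq> 0" "x + 2 \<noteq> 0" "x + y \<noteq> 0" using xy by linarith+
    have 1: "(x + 2 * y) * y / x ^ 2 * (x ^ 2 / ((x + 1) * (x + 2))) = \<alpha>"
      using xy by (simp add: \<alpha>_def)
    have 2: "\<alpha> * ((x + 1) * (x + 2) * h * (1 / y) * (1 / (x + y))) = \<beta> * h"
      using xy nz by (simp add: \<alpha>_def \<beta>_def)
    have "P * Q * u * S * (R * v * (1 - h / 4 + 3 / 4 * z)) =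
        P * Q * S * R * (u * v * (1 - h / 4) + 3 / 4 * (u * v * z))" for P Q u v z
      by (simp add: algebra_simps)
    then show ?thesis
      unfolding \<alpha>_def[symmetric] \<beta>_def[symmetric] by (simp only: 1 2) (simp add: algebra_simps)
  qed
  also have "\<dots> = asymptotic_value g (m + 2 * g) * error_factor m g"
    unfolding asymptotic_value_eq[OF m assms(2)] error_factor_def h
    by (simp add: x_def y_def S_def R_def h_def)
  finally show "real (num_embeddings g (double_cycle (m + 2 * g)) (double_cycle_rev (m + 2 * g))) =
    asymptotic_value g (m + 2 * g) * error_factor m g" .
  show "asymptotic_value g (m + 2 * g) > 0"
    unfolding asymptotic_value_eq[OF m assms(2)] using assms by simp
qed

text \<open>The source of uniformity: \<open>m\<close> and \<open>g\<close> tend to infinity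
  independently, with no relation between them.\<close>

lemma error_factor_tendsto_1:
  "((\<lambda>(m, g). error_factor m g) \<longlongrightarrow> 1) (at_top \<times>\<^sub>F at_top)"
proof -
  let ?F = "(at_top \<times>\<^sub>F at_top) :: (nat \<times> nat) filter"
  have m: "filterlim fst at_top ?F" and g: "filterlim snd at_top ?F"
    by (rule filterlim_fst filterlim_snd)+
  have mg: "filterlim (\<lambda>x. fst x + snd x) at_top ?F"
    by (rule filterlim_at_top_mono[OF m]) simp
  have st: "((\<lambda>x. stirling_ratio (f x)) \<longlongrightarrow> 1) ?F" if "filterlim f at_top ?F" for f
    by (rule filterlim_compose[OF stirling_ratio_tendsto_1 that])
  have 1: "((\<lambda>x. real (fst x) ^ 2 / ((real (fst x) + 1) * (real (fst x) + 2))) \<longlongrightarrow> 1) ?F"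
    by (rule filterlim_compose[OF _ m]) real_asymp
  have 2: "((\<lambda>x. (1 / 2 :: real) ^ (fst x + 2)) \<longlongrightarrow> 0) ?F"
    by (rule filterlim_compose[OF _ m]) real_asymp
  have 3: "((\<lambda>x. (real (fst x) + 1) * (real (fst x) + 2) * (1 / 2) ^ fst x) \<longlongrightarrow> 0) ?F"
    by (rule filterlim_compose[OF _ m]) real_asymp
  have inv: "((\<lambda>x. 1 / real (f x)) \<longlongrightarrow> 0) ?F" if "filterlim f at_top ?F" for f
    by (rule filterlim_compose[OF lim_1_over_n that])
  have "((\<lambda>x. stirling_ratio (fst x + snd x) / (stirling_ratio (fst x) * stirling_ratio (snd x)) *
     (real (fst x) ^ 2 / ((real (fst x) + 1) * (real (fst x) + 2))) *
     (1 - (1 / 2) ^ (fst x + 2) + 3 / 4 * (((real (fst x) + 1) * (real (fst x) + 2) * (1 / 2) ^ fst x) *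
       (1 / real (snd x)) * (1 / real (fst x + snd x))))) \<longlongrightarrow> 1 / (1 * 1) * 1 * (1 - 0 + 3 / 4 * (0 * 0 * 0))) ?F"
    by (intro tendsto_intros st 1 2 3 inv m g mg) simp
  then show ?thesis
    by (simp add: error_factor_def[abs_def] case_prod_unfold)
qed

lemma num_embeddings_asymptotics:
  fixes a b \<epsilon> :: real
  assumes "0 < a" "b < 1 / 2" "\<epsilon> > 0"
  shows "\<exists>N. \<forall>n\<ge>N. \<forall>g. real g / real n \<in> {a..b} \<longrightarrow>
    \<bar>real (num_embeddings g (double_cycle n) (double_cycle_rev n)) / asymptotic_value g n - 1\<bar> < \<epsilon>"
proof -
  have "eventually (\<lambda>(m, g). dist (error_factor m g) 1 < \<epsilon>) (sequentially \<times>\<^sub>F sequentially)"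
    using tendstoD[OF error_factor_tendsto_1 assms(3)] by (simp add: case_prod_unfold)
  then obtain M where M: "\<And>m g. m \<ge> M \<Longrightarrow> g \<ge> M \<Longrightarrow> \<bar>error_factor m g - 1\<bar> < \<epsilon>"
    unfolding eventually_prod_sequentially dist_real_def by auto
  \<comment> \<open>The \<open>3\<close> ensures \<open>m > 2\<close> and \<open>g > 0\<close>
    besides \<open>m, g \<ge> M\<close>. The bound \<open>N\<close> uses
    \<open>g \<ge> a * n\<close> and \<open>n - 2 * g \<ge> (1 - 2 * b) * n\<close>.\<close>
  define K where "K = real M + 3"
  define N where "N = nat \<lceil>K / a\<rceil> + nat \<lceil>K / (1 - 2 * b)\<rceil>"
  show ?thesis
  proof (intro exI[of _ N] allI impI)
    fix n g assume n: "n \<ge> N" and g: "real g / real n \<in> {a..b}"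
    have K: "K \<ge> 3" by (simp add: K_def)
    \<comment> \<open>For \<open>n = 0\<close> the quotient \<open>g / n\<close> is \<open>0\<close>
      by convention, which lies below \<open>a\<close>.\<close>
    have "n > 0"
      using g assms(1) by (cases "n = 0") auto
    then have g': "a * n \<le> real g" "real g \<le> b * n"
      using g by (simp_all add: field_simps)
    have "K / a \<le> real n" "K / (1 - 2 * b) \<le> real n"
      using n unfolding N_def by linarith+
    then have "K \<le> a * n" "K \<le> (1 - 2 * b) * n"
      using assms by (simp_all add: field_simps)
    then have gK: "real g \<ge> K" and mK: "real n - 2 * real g \<ge> K"
      using g' by (simp_all add: algebra_simps)
    obtain m where m: "n = m + 2 * g"
      using mK K by (metis add.commute le_Suc_ex of_nat_le_iff of_nat_mult of_nat_numeral diff_ge_0_iff_ge order.trans zero_le_numeral)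
    have "real m \<ge> K" using mK by (simp add: m)
    then have mg: "m \<ge> M" "g \<ge> M" "m > 2" "g > 0"
      using gK by (simp_all add: K_def)
    note val = num_embeddings_over_asymptotic_value[OF mg(3,4)]
    show "\<bar>real (num_embeddings g (double_cycle n) (double_cycle_rev n)) / asymptotic_value g n - 1\<bar> < \<epsilon>"
      using M[OF mg(1,2)] val(2) unfolding m val(1) by simp
  qed
qed

section \<open>The normal limit\<close>

lemma lucas_roots:
  fixes p q :: "'a::comm_ring_1"
  assumes "p + q = c" "p * q = - 12"
  shows "lucas n c = p ^ n + q ^ n"
proof (induction n rule: induct_nat_012)
  case (ge2 n)
  have "(p + q) * (p ^ Suc n + q ^ Suc n) + 12 * (p ^ n + q ^ n) =
      p ^ Suc (Suc n) + q ^ Suc (Suc n) + (p * q + 12) * (p ^ n + q ^ n)"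
    by (simp add: algebra_simps)
  then show ?case
    unfolding lucas.simps(3) ge2 unfolding assms(2) by (simp add: assms(1))
qed (use assms in simp_all)

text \<open>The base \<open>5\<close> works because \<open>2 * 5 + 12 \<le> 5 * 5\<close>; what
  matters later is that it is below \<open>6\<close>.\<close>

lemma norm_lucas_le:
  fixes c :: complex
  assumes "norm c \<le> 2"
  shows "norm (lucas n c) \<le> 2 * 5 ^ n"
proof (induction n rule: induct_nat_012)
  case (ge2 n)
  have "norm (lucas (Suc (Suc n)) c) \<le> norm c * norm (lucas (Suc n) c) + 12 * norm (lucas n c)"
    by (simp add: norm_mult order.trans[OF norm_triangle_ineq])
  also have "\<dots> \<le> 2 * (2 * 5 ^ Suc n) + 12 * (2 * 5 ^ n)"
    by (intro add_mono mult_mono ge2 assms) auto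
  also have "\<dots> \<le> 2 * 5 ^ Suc (Suc n)"
    by simp
  finally show ?case .
qed (use assms in simp_all)

text \<open>At \<open>x = 1\<close> the roots are \<open>6\<close> and \<open>-2\<close>, the factor
  \<open>x^2 - 1\<close> vanishes, and the power-of-two summand cancels
  \<open>(-2) ^ n\<close>.\<close>

lemma card_rotation_systems:
  assumes "n > 0"
  shows "card (rotation_systems (double_cycle n)) = 6 ^ n"
proof -
  have "lucas n (4::real) = 6 ^ n + (- 2) ^ n"
    by (rule lucas_roots) simp_all
  then have "face_polynomial n (1::real) = 6 ^ n"
    using assms by (cases n) (simp_all add: face_polynomial_def)
  then have "real (card (rotation_systems (double_cycle n))) = real (6 ^ n)"
    using sum_power_card_faces_field[OF assms, of "1::real"] by simp
  then show ?thesis by (simp only: of_nat_eq_iff)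
qed

text \<open>After passing to \<open>Ln\<close>, the error is at most
  \<open>2 * |n \<nu>| * |\<nu>|\<close>, which vanishes because convergence of
  \<open>n \<nu>\<close> forces \<open>\<nu>\<close> to tend to \<open>0\<close>.\<close>

lemma tendsto_power_exp_complex:
  fixes \<nu> :: "nat \<Rightarrow> complex"
  assumes "(\<lambda>n. of_nat n * \<nu> n) \<longlonglongrightarrow> c"
  shows "(\<lambda>n. (1 + \<nu> n) ^ n) \<longlonglongrightarrow> exp c"
proof -
  have "(\<lambda>n. of_nat n * \<nu> n * (1 / of_nat n)) \<longlonglongrightarrow> c * 0"
    by (intro tendsto_mult assms lim_1_over_n)
  moreover have "\<forall>\<^sub>F n in sequentially. of_nat n * \<nu> n * (1 / of_nat n) = \<nu> n"
    by (intro eventually_sequentiallyI[of 1]) simp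
  ultimately have \<nu>: "\<nu> \<longlonglongrightarrow> 0"
    using tendsto_cong by fastforce
  then have small: "\<forall>\<^sub>F n in sequentially. norm (\<nu> n) < 1 / 2"
    using tendstoD[OF \<nu>, of "1 / 2"] by simp
  have "(\<lambda>n. of_nat n * (Ln (1 + \<nu> n) - \<nu> n)) \<longlonglongrightarrow> 0"
  proof (rule Lim_null_comparison)
    show "\<forall>\<^sub>F n in sequentially. norm (of_nat n * (Ln (1 + \<nu> n) - \<nu> n)) \<le>
        2 * (norm (of_nat n * \<nu> n) * norm (\<nu> n))"
      using small
    proof eventually_elim
      case (elim n)
      have "norm (Ln (1 + \<nu> n) - \<nu> n) \<le> norm (\<nu> n) ^ 2 / (1 - norm (\<nu> n))"
        using elim by (intro Ln_approx_linear) simp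
      also have "\<dots> \<le> norm (\<nu> n) ^ 2 / (1 / 2)"
        using elim by (intro divide_left_mono) auto
      finally show ?case
        by (simp add: norm_mult power2_eq_square mult_left_mono mult.assoc mult.left_commute)
    qed
    have "(\<lambda>n. 2 * (norm (of_nat n * \<nu> n) * norm (\<nu> n))) \<longlonglongrightarrow> 2 * (norm c * norm (0::complex))"
      by (intro tendsto_intros assms \<nu>)
    then show "(\<lambda>n. 2 * (norm (of_nat n * \<nu> n) * norm (\<nu> n))) \<longlonglongrightarrow> 0" by simp
  qed
  from tendsto_add[OF this assms] have "(\<lambda>n. of_nat n * Ln (1 + \<nu> n)) \<longlonglongrightarrow> c"
    by (simp add: algebra_simps)
  then have "(\<lambda>n. exp (of_nat n * Ln (1 + \<nu> n))) \<longlonglongrightarrow> exp c"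
    by (rule tendsto_exp)
  moreover have "\<forall>\<^sub>F n in sequentially. exp (of_nat n * Ln (1 + \<nu> n)) = (1 + \<nu> n) ^ n"
    using small
  proof eventually_elim
    case (elim n)
    have "1 + \<nu> n \<noteq> 0"
    proof
      assume "1 + \<nu> n = 0"
      then have "norm (\<nu> n) = norm (- 1 :: complex)"
        by (simp add: add_eq_0_iff)
      then show False using elim by simp
    qed
    then show ?case by (simp add: exp_of_nat_mult)
  qed
  ultimately show ?thesis
    using tendsto_cong by fastforce
qed

lemma iexp_second_order: "norm (iexp x - (1 + \<i> * x - x\<^sup>2 / 2)) \<le> \<bar>x\<bar> ^ 3"
proof -
  have "(\<Sum>k\<le>2. (\<i> * x) ^ k / fact k) = 1 + \<i> * x - x\<^sup>2 / 2"
    by (simp add: numeral_2_eq_2 power_mult_distrib)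
  then have "norm (iexp x - (1 + \<i> * x - x\<^sup>2 / 2)) \<le> \<bar>x\<bar> ^ 3 / 6"
    using iexp_approx1[of x 2] by (simp add: numeral_3_eq_3 fact_numeral)
  also have "\<dots> \<le> \<bar>x\<bar> ^ 3" by simp
  finally show ?thesis .
qed

text \<open>The phase \<open>\<theta> n * (n / 2)\<close> centres the number of faces at
  \<open>n / 2\<close>, while the extra \<open>2 * \<theta> n\<close> tends to \<open>0\<close>. Of
  all summands only the power of the root near \<open>6\<close> survives the division by
  \<open>6 ^ n\<close>.\<close>

lemma face_polynomial_scaled_tendsto:
  fixes \<theta> :: "nat \<Rightarrow> real" and s :: real
  assumes \<theta>0: "\<theta> \<longlonglongrightarrow> 0" and \<theta>2: "(\<lambda>n. real n * (\<theta> n)\<^sup>2) \<longlonglongrightarrow> 8 / 3 * s\<^sup>2"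
  shows "(\<lambda>n. iexp (\<theta> n * (real n / 2 + 2)) * face_polynomial n (iexp (- \<theta> n)) / 6 ^ n)
    \<longlonglongrightarrow> exp (- (s\<^sup>2 / 2))"
proof -
  define x where "x = (\<lambda>n. iexp (- \<theta> n))"
  define \<mu> where "\<mu> = (\<lambda>n. csqrt (x n ^ 2 + 3))"
  define p where "p = (\<lambda>n. 2 * (x n + \<mu> n))"
  define q where "q = (\<lambda>n. 2 * (x n - \<mu> n))"
  define E where "E = (\<lambda>n. iexp (- \<theta> n / 2))"
  \<comment> \<open>\<open>p n / 6\<close> is the dominant factor per vertex, and
    \<open>iexp (\<theta> n / 2)\<close> removes the mean of half a face per vertex; this makes
    \<open>\<nu>\<close> of second order in \<open>\<theta>\<close>.\<close>
  define \<nu> where "\<nu> = (\<lambda>n. iexp (\<theta> n / 2) * p n / 6 - 1)"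
  have iexp0: "(\<lambda>n. iexp (f n)) \<longlonglongrightarrow> 1" if "f \<longlonglongrightarrow> 0" for f :: "nat \<Rightarrow> real"
  proof -
    have "(\<lambda>n. iexp (f n)) \<longlonglongrightarrow> iexp 0"
      by (intro tendsto_intros that)
    then show ?thesis by simp
  qed
  have x1: "x \<longlonglongrightarrow> 1"
    unfolding x_def by (rule iexp0) (use tendsto_minus[OF \<theta>0] in simp)
  have E1: "E \<longlonglongrightarrow> 1"
    unfolding E_def by (rule iexp0) (use tendsto_divide[OF tendsto_minus[OF \<theta>0] tendsto_const[of 2]] in simp)
  have half: "(\<lambda>n. iexp (\<theta> n / 2)) \<longlonglongrightarrow> 1"
    by (rule iexp0) (use tendsto_divide[OF \<theta>0 tendsto_const[of 2]] in simp)
  have "(\<lambda>n. csqrt (x n ^ 2 + 3)) \<longlonglongrightarrow> csqrt (1 ^ 2 + 3)"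
  proof (rule isCont_tendsto_compose[where g = csqrt])
    show "isCont csqrt (1\<^sup>2 + 3)"
      by (rule continuous_at_csqrt) simp
    show "(\<lambda>n. x n ^ 2 + 3) \<longlonglongrightarrow> 1\<^sup>2 + 3"
      by (intro tendsto_intros x1)
  qed
  moreover have "csqrt (1\<^sup>2 + 3) = 2"
    using csqrt_square[of 2] by simp
  ultimately have \<mu>2: "\<mu> \<longlonglongrightarrow> 2"
    unfolding \<mu>_def by simp
  have "p \<longlonglongrightarrow> 2 * (1 + 2)" "q \<longlonglongrightarrow> 2 * (1 - 2)"
    unfolding p_def q_def by (intro tendsto_intros x1 \<mu>2)+
  then have p6: "p \<longlonglongrightarrow> 6" and q2: "q \<longlonglongrightarrow> - 2" by simp_all
  have prod: "p n * q n = - 12" for n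
  proof -
    have \<mu>\<mu>: "\<mu> n * \<mu> n = x n * x n + 3"
      using power2_csqrt[of "x n ^ 2 + 3"] by (simp add: \<mu>_def power2_eq_square)
    have "p n * q n = 4 * (x n * x n - \<mu> n * \<mu> n)"
      by (simp add: p_def q_def algebra_simps)
    then show ?thesis unfolding \<mu>\<mu> by simp
  qed
  have lucas4: "lucas n (4 * x n) = p n ^ n + q n ^ n" for n
    by (rule lucas_roots) (simp_all add: prod, simp add: p_def q_def)

  have "(\<lambda>n. iexp (\<theta> n / 2) * p n / 6 - 1) \<longlonglongrightarrow> 1 * 6 / 6 - 1"
    by (intro tendsto_intros half p6) simp
  then have \<nu>0: "\<nu> \<longlonglongrightarrow> 0" unfolding \<nu>_def by simp
  \<comment> \<open>The equation \<open>p\<^sup>2 = 4 x p + 12\<close> in terms of \<open>\<nu>\<close>: its right-hand side is of second order in \<open>\<theta>\<close>, so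
     no expansion of the square root in \<open>\<mu>\<close> is needed.\<close>
  have quad: "\<nu> n * (6 - 2 * E n + 3 * \<nu> n) = 2 * E n + iexp (\<theta> n) - 3" for n
  proof -
    define e where "e = iexp (\<theta> n / 2)"
    have eE: "e * E n = 1"
      by (simp add: e_def E_def flip: exp_add)
    have xE: "x n = E n * E n"
      by (simp add: x_def E_def flip: exp_add)
    have ie: "iexp (\<theta> n) = e * e"
      by (simp add: e_def flip: exp_add)
    have "p n * p n - 4 * x n * p n = 12"
    proof -
      have "q n = 4 * x n - p n" by (simp add: p_def q_def)
      then have "p n * (4 * x n - p n) = - 12" using prod[of n] by simp
      then show ?thesis by (simp add: right_diff_distrib mult_ac) (metis minus_diff_eq add.inverse_inverse)
    qed
    then have "e * e * (p n * p n) - 4 * (e * E n) * (e * E n) * p n = 12 * (e * e)"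
      unfolding xE by (simp add: algebra_simps)
    then have pp: "e * e * (p n * p n) - 4 * p n = 12 * (e * e)"
      unfolding eE by simp
    have nu: "\<nu> n = e * p n / 6 - 1" by (simp add: \<nu>_def e_def)
    have "\<nu> n * (6 - 2 * E n + 3 * \<nu> n) - (2 * E n + iexp (\<theta> n) - 3) =
        (e * e * (p n * p n) - 4 * (e * E n) * p n - 12 * (e * e)) / 12"
      unfolding nu ie by (simp add: field_simps)
    also have "\<dots> = 0" unfolding eE using pp by simp
    finally show ?thesis by simp
  qed
  \<comment> \<open>The constant and linear terms cancel, and the quadratic one is
    \<open>- (3/4) \<theta>^2\<close>; times \<open>n\<close> it tends to
    \<open>- (3/4) * (8/3) * s^2 = - 2 s^2\<close>. Division by the limit \<open>4\<close> of the
    denominator gives \<open>- s^2 / 2\<close>.\<close>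
  have rhs: "(\<lambda>n. of_nat n * (2 * E n + iexp (\<theta> n) - 3)) \<longlonglongrightarrow> - (2 * of_real s ^ 2)"
  proof -
    have \<theta>3: "(\<lambda>n. 3 * (real n * (\<theta> n)\<^sup>2 * \<bar>\<theta> n\<bar>)) \<longlonglongrightarrow> 0"
      using tendsto_mult[OF tendsto_const[of 3] tendsto_mult[OF \<theta>2 tendsto_rabs[OF \<theta>0]]] by simp
    have "(\<lambda>n. of_nat n * (2 * E n + iexp (\<theta> n) - 3) + of_real (3 / 4 * (real n * (\<theta> n)\<^sup>2))) \<longlonglongrightarrow> 0"
    proof (rule Lim_null_comparison[OF always_eventually \<theta>3], rule allI)
      fix n
      let ?t = "\<theta> n"
      define r1 where "r1 = E n - (1 + \<i> * of_real (- ?t / 2) - of_real (- ?t / 2) ^ 2 / 2)"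
      define r2 where "r2 = iexp ?t - (1 + \<i> * of_real ?t - of_real ?t ^ 2 / 2)"
      have r1: "norm r1 \<le> \<bar>?t\<bar> ^ 3"
      proof -
        have "norm r1 \<le> \<bar>- ?t / 2\<bar> ^ 3"
          using iexp_second_order[of "- ?t / 2"] by (simp add: r1_def E_def)
        also have "\<dots> \<le> \<bar>?t\<bar> ^ 3" by (intro power_mono) auto
        finally show ?thesis .
      qed
      have r2: "norm r2 \<le> \<bar>?t\<bar> ^ 3"
        using iexp_second_order[of ?t] by (simp add: r2_def)
      have "of_nat n * (2 * E n + iexp ?t - 3) + of_real (3 / 4 * (real n * ?t\<^sup>2)) = of_nat n * (2 * r1 + r2)"
        by (simp add: r1_def r2_def field_simps power2_eq_square)
      also have "norm \<dots> \<le> real n * (2 * norm r1 + norm r2)"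
        by (simp add: norm_mult mult_left_mono order.trans[OF norm_triangle_ineq])
      also have "\<dots> \<le> real n * (2 * \<bar>?t\<bar> ^ 3 + \<bar>?t\<bar> ^ 3)"
        by (intro mult_left_mono add_mono r1 r2) auto
      also have "\<dots> = 3 * (real n * ?t\<^sup>2 * \<bar>?t\<bar>)"
        by (simp add: power3_eq_cube power2_eq_square abs_mult_self_eq)
      finally show "norm (of_nat n * (2 * E n + iexp ?t - 3) + of_real (3 / 4 * (real n * ?t\<^sup>2))) \<le>
          3 * (real n * ?t\<^sup>2 * \<bar>?t\<bar>)" .
    qed
    from tendsto_diff[OF this tendsto_of_real[OF tendsto_mult[OF tendsto_const[of "3 / 4"] \<theta>2]]]
    show ?thesis by simp
  qed
  have den: "(\<lambda>n. 6 - 2 * E n + 3 * \<nu> n) \<longlonglongrightarrow> 6 - 2 * 1 + 3 * 0"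
    by (intro tendsto_intros E1 \<nu>0)
  have "(\<lambda>n. of_nat n * (2 * E n + iexp (\<theta> n) - 3) / (6 - 2 * E n + 3 * \<nu> n)) \<longlonglongrightarrow>
      - (2 * of_real s ^ 2) / (6 - 2 * 1 + 3 * 0)"
    by (intro tendsto_divide rhs den) simp
  moreover have "\<forall>\<^sub>F n in sequentially. of_nat n * (2 * E n + iexp (\<theta> n) - 3) / (6 - 2 * E n + 3 * \<nu> n) =
      of_nat n * \<nu> n"
  proof -
    have "\<forall>\<^sub>F n in sequentially. 6 - 2 * E n + 3 * \<nu> n \<noteq> 0"
      by (rule tendsto_imp_eventually_ne[OF den]) simp
    then show ?thesis
      by eventually_elim (simp flip: quad)
  qed
  ultimately have "(\<lambda>n. of_nat n * \<nu> n) \<longlonglongrightarrow> - (of_real s ^ 2 / 2)"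
    by (simp add: tendsto_cong)
  then have pow: "(\<lambda>n. (1 + \<nu> n) ^ n) \<longlonglongrightarrow> exp (- (of_real s ^ 2 / 2))"
    by (rule tendsto_power_exp_complex)
  have two: "(\<lambda>n. iexp (2 * \<theta> n)) \<longlonglongrightarrow> 1"
    by (rule iexp0) (use tendsto_mult[OF tendsto_const[of 2] \<theta>0] in simp)
  from tendsto_mult[OF two pow]
  have main: "(\<lambda>n. iexp (2 * \<theta> n) * (1 + \<nu> n) ^ n) \<longlonglongrightarrow> exp (- (of_real s ^ 2 / 2))"
    by simp
  \<comment> \<open>The remainder: \<open>q ^ n\<close> with \<open>q\<close> near
    \<open>-2\<close>, the \<open>2 * x\<close> family of size at most \<open>5 ^ n\<close>, and the
    powers of two.\<close>
  define R where "R = (\<lambda>n. iexp (\<theta> n * (real n / 2 + 2)) * (q n ^ n + (x n ^ 2 - 1) * lucas n (2 * x n) +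
      2 ^ (n - 1) * (if even n then x n ^ 4 - 3 * x n ^ 2 else 2 * x n ^ 3)) / 6 ^ n)"
  have R0: "R \<longlonglongrightarrow> 0"
  proof (rule Lim_null_comparison)
    have "\<forall>\<^sub>F n in sequentially. norm (q n) < 3"
      using order_tendstoD(2)[OF tendsto_norm[OF q2], of 3] by simp
    then show "\<forall>\<^sub>F n in sequentially. norm (R n) \<le> (3 ^ n + 4 * 5 ^ n + 4 * 2 ^ n) / 6 ^ n"
    proof eventually_elim
      case (elim n)
      have nx: "norm (x n) = 1" by (simp add: x_def)
      have "norm (q n ^ n) \<le> 3 ^ n"
        unfolding norm_power using elim by (intro power_mono) auto
      moreover have "norm ((x n ^ 2 - 1) * lucas n (2 * x n)) \<le> 2 * (2 * 5 ^ n)"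
        unfolding norm_mult
      proof (intro mult_mono norm_lucas_le)
        show "norm (x n ^ 2 - 1) \<le> 2"
          using norm_triangle_ineq4[of "x n ^ 2" 1] by (simp add: norm_power nx)
      qed (simp_all add: norm_mult nx)
      moreover have "norm (2 ^ (n - 1) * (if even n then x n ^ 4 - 3 * x n ^ 2 else 2 * x n ^ 3)) \<le> 2 ^ n * 4"
        unfolding norm_mult
      proof (intro mult_mono)
        show "norm (2 ^ (n - 1) :: complex) \<le> 2 ^ n"
          by (simp add: norm_power)
        show "norm (if even n then x n ^ 4 - 3 * x n ^ 2 else 2 * x n ^ 3) \<le> 4"
          using norm_triangle_ineq4[of "x n ^ 4" "3 * x n ^ 2"] by (simp add: norm_power norm_mult nx)
      qed simp_all
      ultimately have "norm (q n ^ n + (x n ^ 2 - 1) * lucas n (2 * x n) +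
          2 ^ (n - 1) * (if even n then x n ^ 4 - 3 * x n ^ 2 else 2 * x n ^ 3)) \<le>
          3 ^ n + 4 * 5 ^ n + 4 * 2 ^ n"
        by (intro order.trans[OF norm_triangle_ineq] order.trans[OF add_mono[OF norm_triangle_ineq order.refl]]) linarith
      then show ?case
        by (simp add: R_def norm_mult norm_divide norm_power divide_right_mono)
    qed
    have "(\<lambda>n. (3 / 6) ^ n + 4 * (5 / 6) ^ n + 4 * (2 / 6) ^ n :: real) \<longlonglongrightarrow> 0 + 4 * 0 + 4 * 0"
      by (intro tendsto_add tendsto_mult tendsto_const LIMSEQ_realpow_zero) simp_all
    moreover have "(\<lambda>n. (3 ^ n + 4 * 5 ^ n + 4 * 2 ^ n) / 6 ^ n :: real) =
        (\<lambda>n. (3 / 6) ^ n + 4 * (5 / 6) ^ n + 4 * (2 / 6) ^ n)"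
      by (simp only: power_divide add_divide_distrib times_divide_eq_right)
    ultimately show "(\<lambda>n. (3 ^ n + 4 * 5 ^ n + 4 * 2 ^ n) / 6 ^ n :: real) \<longlonglongrightarrow> 0"
      by (simp only: mult_zero_right add_0_right)
  qed
  have "iexp (\<theta> n * (real n / 2 + 2)) * face_polynomial n (iexp (- \<theta> n)) / 6 ^ n =
      iexp (2 * \<theta> n) * (1 + \<nu> n) ^ n + R n" for n
  proof -
    have "iexp (\<theta> n * (real n / 2 + 2)) = iexp (2 * \<theta> n) * iexp (\<theta> n / 2) ^ n"
      by (simp add: algebra_simps flip: exp_of_nat_mult exp_add)
    then have main_term: "iexp (\<theta> n * (real n / 2 + 2)) * p n ^ n / 6 ^ n =
        iexp (2 * \<theta> n) * (1 + \<nu> n) ^ n"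
      by (simp add: \<nu>_def power_mult_distrib power_divide)
    have xn: "iexp (- \<theta> n) = x n"
      by (simp add: x_def)
    have split: "face_polynomial n (x n) = p n ^ n + (q n ^ n + (x n ^ 2 - 1) * lucas n (2 * x n) +
        2 ^ (n - 1) * (if even n then x n ^ 4 - 3 * x n ^ 2 else 2 * x n ^ 3))"
      unfolding face_polynomial_def lucas4 by (simp only: add.assoc)
    have "w * (a + b) / 6 ^ n = w * a / 6 ^ n + w * b / 6 ^ n" for w a b :: complex
      by (simp add: distrib_left add_divide_distrib)
    then show ?thesis
      unfolding xn split R_def main_term[symmetric] by this
  qed
  moreover have "(\<lambda>n. iexp (2 * \<theta> n) * (1 + \<nu> n) ^ n + R n) \<longlonglongrightarrow> exp (- (of_real s ^ 2 / 2)) + 0"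
    by (intro tendsto_add main R0)
  moreover have "exp (- (of_real s ^ 2 / 2)) = complex_of_real (exp (- (s\<^sup>2 / 2)))"
    by (simp flip: exp_of_real)
  ultimately show ?thesis
    by (simp only: add_0_right)
qed

text \<open>The genus is \<open>(n + 2 - f) / 2\<close>, so its characteristic function is a phase
  times the generating polynomial of \<open>f\<close> at a point of the unit circle.\<close>

lemma char_genus_distribution:
  fixes e v s :: real
  assumes "n > 0"
  shows "char (distr (measure_pmf (genus_distribution (double_cycle n) (double_cycle_rev n))) borel
      (\<lambda>x. (x - e) / v)) s =
    iexp (s / v * ((real n + 2) / 2 - e)) * face_polynomial n (iexp (- (s / (2 * v)))) / 6 ^ n"
proof -
  let ?RS = "rotation_systems (double_cycle n)"
  let ?F = "\<lambda>\<sigma>. card (faces (double_cycle n) (double_cycle_rev n) \<sigma>)"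
  have fin: "finite ?RS" by (rule finite_rotation_systems)
  have ne: "?RS \<noteq> {}" using card_rotation_systems[OF assms] by auto
  have "char (distr (measure_pmf (genus_distribution (double_cycle n) (double_cycle_rev n))) borel
      (\<lambda>x. (x - e) / v)) s =
      (\<integral>\<sigma>. iexp (s * ((genus (double_cycle n) (double_cycle_rev n) \<sigma> - e) / v)) \<partial>measure_pmf (pmf_of_set ?RS))"
    unfolding char_def genus_distribution_def by (subst integral_distr) simp_all
  also have "\<dots> = (\<Sum>\<sigma>\<in>?RS. pmf (pmf_of_set ?RS) \<sigma> *\<^sub>R iexp (s * ((genus (double_cycle n) (double_cycle_rev n) \<sigma> - e) / v)))"
    using fin ne by (intro integral_measure_pmf) auto
  also have "\<dots> = (\<Sum>\<sigma>\<in>?RS. iexp (s / v * ((real n + 2) / 2 - e)) * iexp (- (s / (2 * v))) ^ ?F \<sigma> / 6 ^ n)"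
  proof (rule sum.cong[OF refl])
    fix \<sigma> assume \<sigma>: "\<sigma> \<in> ?RS"
    have "s * ((genus (double_cycle n) (double_cycle_rev n) \<sigma> - e) / v) =
        s / v * ((real n + 2) / 2 - e) + real (?F \<sigma>) * - (s / (2 * v))"
      unfolding genus_double_cycle by (cases "v = 0") (simp_all add: field_simps)
    then have eq: "iexp (s * ((genus (double_cycle n) (double_cycle_rev n) \<sigma> - e) / v)) =
        iexp (s / v * ((real n + 2) / 2 - e)) * exp (of_nat (?F \<sigma>) * (\<i> * of_real (- (s / (2 * v)))))"
    proof -
      have "\<i> * of_real (A + real k * B) = \<i> * of_real A + of_nat k * (\<i> * of_real B)" for A B k
        by (simp add: algebra_simps)
      then show ?thesis
        using \<open>s * _ = _\<close> by (simp only: exp_add)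
    qed
    have "pmf (pmf_of_set ?RS) \<sigma> = 1 / 6 ^ n"
      using fin ne \<sigma> by (simp add: card_rotation_systems[OF assms])
    then show "pmf (pmf_of_set ?RS) \<sigma> *\<^sub>R iexp (s * ((genus (double_cycle n) (double_cycle_rev n) \<sigma> - e) / v)) =
        iexp (s / v * ((real n + 2) / 2 - e)) * iexp (- (s / (2 * v))) ^ ?F \<sigma> / 6 ^ n"
      unfolding eq exp_of_nat_mult by (simp only: scaleR_conv_of_real of_real_divide of_real_power) simp
  qed
  also have "\<dots> = iexp (s / v * ((real n + 2) / 2 - e)) * (\<Sum>\<sigma>\<in>?RS. iexp (- (s / (2 * v))) ^ ?F \<sigma>) / 6 ^ n"
    by (simp only: sum_distrib_left sum_divide_distrib)
  finally show ?thesis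
    by (simp only: sum_power_card_faces_field[OF assms])
qed

lemma asymptotically_normal_double_cycle:
  "asymptotically_normal (\<lambda>n. genus_distribution (double_cycle n) (double_cycle_rev n))
     (\<lambda>n. 1 / 4 * real n) (\<lambda>n. 3 / 32 * real n)"
  unfolding asymptotically_normal_def
proof (rule levy_continuity)
  let ?M = "\<lambda>n. distr (measure_pmf (genus_distribution (double_cycle n) (double_cycle_rev n))) borel
      (\<lambda>x. (x - 1 / 4 * real n) / sqrt (3 / 32 * real n))"
  show "real_distribution (?M n)" for n
    by (rule prob_space.real_distribution_distr) (auto intro: prob_space_measure_pmf)
  show "real_distribution std_normal_distribution"
    by (rule real_dist_normal_dist)
  fix s :: real
  \<comment> \<open>One more face lowers the genus by \<open>1/2\<close>, hence the \<open>2\<close>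
    in the denominator. For \<open>n > 0\<close> this gives
    \<open>n \<theta>^2 = s^2 / (4 * 3/32) = (8/3) s^2\<close>.\<close>
  define \<theta> where "\<theta> = (\<lambda>n. s / (2 * sqrt (3 / 32 * real n)))"
  have "(\<lambda>n. s * (1 / (2 * sqrt (3 / 32 * real n)))) \<longlonglongrightarrow> s * 0"
    by (intro tendsto_mult tendsto_const) real_asymp
  then have \<theta>0: "\<theta> \<longlonglongrightarrow> 0" by (simp add: \<theta>_def)
  have "\<forall>\<^sub>F n in sequentially. real n * (\<theta> n)\<^sup>2 = 8 / 3 * s\<^sup>2"
    by (intro eventually_sequentiallyI[of 1]) (simp add: \<theta>_def power_divide power_mult_distrib)
  then have \<theta>2: "(\<lambda>n. real n * (\<theta> n)\<^sup>2) \<longlonglongrightarrow> 8 / 3 * s\<^sup>2"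
    by (rule tendsto_eventually)
  have "\<forall>\<^sub>F n in sequentially. char (?M n) s =
      iexp (\<theta> n * (real n / 2 + 2)) * face_polynomial n (iexp (- \<theta> n)) / 6 ^ n"
  proof (rule eventually_sequentiallyI)
    fix n :: nat assume "1 \<le> n"
    then show "char (?M n) s = iexp (\<theta> n * (real n / 2 + 2)) * face_polynomial n (iexp (- \<theta> n)) / 6 ^ n"
    proof -
      have "s / sqrt (3 / 32 * real n) * ((real n + 2) / 2 - 1 / 4 * real n) = \<theta> n * (real n / 2 + 2)"
      proof -
        have "(real n + 2) / 2 - 1 / 4 * real n = (real n / 2 + 2) / 2"
          by (simp add: field_simps)
        then show ?thesis by (simp only: \<theta>_def) simp
      qed
      then show ?thesis
        using char_genus_distribution[of n "1 / 4 * real n" "sqrt (3 / 32 * real n)" s] \<open>1 \<le> n\<close>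
        by (simp add: \<theta>_def)
    qed
  qed
  then show "(\<lambda>n. char (?M n) s) \<longlonglongrightarrow> char std_normal_distribution s"
    unfolding char_std_normal_distribution
    using face_polynomial_scaled_tendsto[OF \<theta>0 \<theta>2] by (simp add: tendsto_cong)
qed

theorem theorem5p1:
  shows "asymptotically_normal
           (\<lambda>n. genus_distribution (double_cycle n) (double_cycle_rev n))
           (\<lambda>n. 1 / 4 * real n) (\<lambda>n. 3 / 32 * real n)
       \<and> (\<forall>a b :: real. 0 < a \<and> a \<le> b \<and> b < 1 / 2 \<longrightarrow>
           (\<forall>\<epsilon>>0. \<exists>N. \<forall>n\<ge>N. \<forall>g::nat. real g / real n \<in> {a..b} \<longrightarrow>
             (let t = 1 / (1 - 2 * real g / real n) in
              \<bar>real (num_embeddings g (double_cycle n) (double_cycle_rev n)) /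
                 (t / 3 * sqrt (2 * t * (t\<^sup>2 - 1) / (pi * real n))
                  * (3 / (t\<^sup>2 - 1)) ^ g * (2 * (1 + t)) ^ n) - 1\<bar> < \<epsilon>)))"
proof (intro conjI allI impI)
  show "asymptotically_normal (\<lambda>n. genus_distribution (double_cycle n) (double_cycle_rev n))
      (\<lambda>n. 1 / 4 * real n) (\<lambda>n. 3 / 32 * real n)"
    by (rule asymptotically_normal_double_cycle)
next
  fix a b \<epsilon> :: real
  assume "0 < a \<and> a \<le> b \<and> b < 1 / 2" "0 < \<epsilon>"
  then show "\<exists>N. \<forall>n\<ge>N. \<forall>g::nat. real g / real n \<in> {a..b} \<longrightarrow>
      (let t = 1 / (1 - 2 * real g / real n) in
       \<bar>real (num_embeddings g (double_cycle n) (double_cycle_rev n)) /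
          (t / 3 * sqrt (2 * t * (t\<^sup>2 - 1) / (pi * real n))
           * (3 / (t\<^sup>2 - 1)) ^ g * (2 * (1 + t)) ^ n) - 1\<bar> < \<epsilon>)"
    using num_embeddings_asymptotics[of a b \<epsilon>] by (simp only: asymptotic_value_def Let_def)
qed

end
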